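(* Let $m\ge1$. The endomorphism semiring $\mathrm{End}(\mathcal{C}_m)$ of the $m$-element chain admits a finite identity basis if and only if $m\le 2$.
   Context: $\mathcal{C}_m$ is the chain $0<1<\dots<m-1$ viewed as a semilattice with $k+\ell:=\max\{k,\ell\}$. $\mathrm{End}(\mathcal{C}_m)$ is the set of all endomorphisms of $\mathcal{C}_m$, made into an additively idempotent semiring (structure of type $(2,2)$) by pointwise addition $x(\alpha+\beta):=x\alpha+x\beta$ and composition $x(\alpha\beta):=(x\alpha)\beta$. A finite identity basis is a finite set of identities valid in the semiring from which all its identities follow. *)

theory Defs
  imports Main
begin

datatype trm = Var nat | Plus trm trm | Times trm trm

fun subst :: "(nat \<Rightarrow> trm) \<Rightarrow> trm \<Rightarrow> trm" where
  "subst \<sigma> (Var x) = \<sigma> x"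
| "subst \<sigma> (Plus s t) = Plus (subst \<sigma> s) (subst \<sigma> t)"
| "subst \<sigma> (Times s t) = Times (subst \<sigma> s) (subst \<sigma> t)"

inductive derivable :: "(trm \<times> trm) set \<Rightarrow> trm \<Rightarrow> trm \<Rightarrow> bool" for E where
  ax: "(s, t) \<in> E \<Longrightarrow> derivable E (subst \<sigma> s) (subst \<sigma> t)"
| refl: "derivable E t t"
| sym: "derivable E s t \<Longrightarrow> derivable E t s"
| trans: "derivable E s t \<Longrightarrow> derivable E t u \<Longrightarrow> derivable E s u"
| cong_plus: "derivable E s1 t1 \<Longrightarrow> derivable E s2 t2 \<Longrightarrow> derivable E (Plus s1 s2) (Plus t1 t2)"
| cong_times: "derivable E s1 t1 \<Longrightarrow> derivable E s2 t2 \<Longrightarrow> derivable E (Times s1 s2) (Times t1 t2)"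

text \<open>End(C_m): endomorphisms of the chain 0<1<...<m-1 as a (max-)semilattice,
  i.e. the order-preserving self-maps of {0..<m}, represented as functions
  nat => nat that are 0 outside {0..<m} (for extensionality).\<close>
definition EndC :: "nat \<Rightarrow> (nat \<Rightarrow> nat) set" where
  "EndC m = {f. (\<forall>x<m. f x < m) \<and>
               (\<forall>x<m. \<forall>y<m. f (max x y) = max (f x) (f y)) \<and>
               (\<forall>x. m \<le> x \<longrightarrow> f x = 0)}"

definition end_add :: "nat \<Rightarrow> (nat \<Rightarrow> nat) \<Rightarrow> (nat \<Rightarrow> nat) \<Rightarrow> (nat \<Rightarrow> nat)" where
  "end_add m f g = (\<lambda>x. if x < m then max (f x) (g x) else 0)"

text \<open>Multiplication x(ab) = (xa)b (maps act on the right).\<close>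
definition end_mult :: "nat \<Rightarrow> (nat \<Rightarrow> nat) \<Rightarrow> (nat \<Rightarrow> nat) \<Rightarrow> (nat \<Rightarrow> nat)" where
  "end_mult m f g = (\<lambda>x. if x < m then g (f x) else 0)"

fun eval_end :: "nat \<Rightarrow> (nat \<Rightarrow> (nat \<Rightarrow> nat)) \<Rightarrow> trm \<Rightarrow> (nat \<Rightarrow> nat)" where
  "eval_end m \<rho> (Var x) = \<rho> x"
| "eval_end m \<rho> (Plus s t) = end_add m (eval_end m \<rho> s) (eval_end m \<rho> t)"
| "eval_end m \<rho> (Times s t) = end_mult m (eval_end m \<rho> s) (eval_end m \<rho> t)"

definition holds_in_End :: "nat \<Rightarrow> trm \<Rightarrow> trm \<Rightarrow> bool" where
  "holds_in_End m s t \<longleftrightarrow>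
     (\<forall>\<rho>. (\<forall>x. \<rho> x \<in> EndC m) \<longrightarrow> eval_end m \<rho> s = eval_end m \<rho> t)"

definition has_finite_identity_basis :: "nat \<Rightarrow> bool" where
  "has_finite_identity_basis m \<longleftrightarrow>
     (\<exists>E. finite E \<and> (\<forall>(s, t)\<in>E. holds_in_End m s t) \<and>
          (\<forall>s t. holds_in_End m s t \<longrightarrow> derivable E s t))"

end

theory Submission
  imports Defs "HOL-Library.Multiset"
begin

text \<open>Both distributive laws hold, so a term denotes a finite set of words, and the value of the term
  at a point is the maximum of the values of its words.

  For \<open>m \<ge> 3\<close> let \<open>w = t\<^sub>0 x\<^sub>0 t\<^sub>1 x\<^sub>1 \<dots> x\<^sub>n t\<^bsub>n+1\<^esub>\<close>, and let \<open>w\<^sub>k\<close> (\<open>0 \<le> k \<le> n + 1\<close>) be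
  \<open>w\<close> with \<open>x\<^bsub>k-1\<^esub>\<close> squared and \<open>x\<^sub>k\<close> deleted, as far as these letters exist. In every chain
  \<open>w \<le> w\<^sub>0 + \<dots> + w\<^bsub>n+1\<^esub>\<close>: if all \<open>w\<^sub>k\<close> were smaller at some point, then inductively every
  \<open>x\<^sub>k\<close> would move the trajectory of \<open>w\<close> strictly upwards, and \<open>w\<^bsub>n+1\<^esub> \<ge> w\<close>. But this
  implication runs through all \<open>x\<^sub>k\<close>: an identity with at most \<open>n\<close> letters per word misses some
  \<open>x\<^sub>r\<close>, and then the trajectory may go up at \<open>x\<^sub>k\<close> for \<open>k < r\<close> and down for \<open>k > r\<close>, which in
  \<open>End(C\<^sub>3)\<close> separates \<open>w\<close> from every other word below \<open>w\<^sub>0 + \<dots> + w\<^bsub>n+1\<^esub>\<close> in which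
  \<open>x\<^sub>r\<close> occurs once.

  For \<open>m = 2\<close> a word \<open>w\<close> lies below a term \<open>t\<close> iff some word of \<open>t\<close> uses only letters of \<open>w\<close>, and for
  every suffix \<open>y b\<close> of \<open>w\<close> with \<open>y\<close> not in \<open>b\<close> some word of \<open>t\<close> ends in \<open>y v\<close> where
  \<open>v\<close> uses only letters of \<open>b\<close>; these conditions can be turned into derivations.\<close>

section \<open>Terms as sets of words\<close>

text \<open>Each occurrence of a variable chooses its word independently, as expansion by the
  distributive laws requires; with \<open>A x = words (\<sigma> x)\<close> this describes a
  substituted term.\<close>

fun choice_words :: "(nat \<Rightarrow> 'a list set) \<Rightarrow> trm \<Rightarrow> 'a list set" where
  "choice_words A (Var x) = A x"
| "choice_words A (Plus s t) = choice_words A s \<union> choice_words A t"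
| "choice_words A (Times s t) = {u @ v | u v. u \<in> choice_words A s \<and> v \<in> choice_words A t}"

abbreviation words :: "trm \<Rightarrow> nat list set" where
  "words \<equiv> choice_words (\<lambda>x. {[x]})"

lemma words_subst: "words (subst \<sigma> t) = choice_words (\<lambda>x. words (\<sigma> x)) t"
  by (induction t) auto

lemma Nil_notin_words: "[] \<notin> words t"
  by (induction t) auto

lemma choice_words_mono:
  assumes "\<And>x. A x \<subseteq> B x"
  shows "choice_words A t \<subseteq> choice_words B t"
  using assms by (induction t) (simp; blast)+

lemma choice_words_concat:
  assumes "q \<in> choice_words A t"
  shows "\<exists>bs. q = concat bs \<and> set bs \<subseteq> (\<Union>x. A x)"
  using assms
proof (induction t arbitrary: q)
  case (Var x)
  then show ?case by (intro exI[of _ "[q]"]) auto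
next
  case (Plus s t)
  then show ?case by auto
next
  case (Times s t)
  then obtain u v where q: "q = u @ v" "u \<in> choice_words A s" "v \<in> choice_words A t" by auto
  obtain bs cs where "u = concat bs" "set bs \<subseteq> (\<Union>x. A x)" "v = concat cs" "set cs \<subseteq> (\<Union>x. A x)"
    using Times.IH(1)[OF q(2)] Times.IH(2)[OF q(3)] by blast
  then show ?case using q(1) by (intro exI[of _ "bs @ cs"]) auto
qed

text \<open>The list \<open>bs\<close> records the blocks chosen at the leaves that produce
  \<open>q\<close>; a term has at most \<open>Suc (size t)\<close> leaves. Cutting every
  \<open>A x\<close> down to these blocks still yields \<open>q\<close>.\<close>

lemma choice_words_blocks:
  assumes "q \<in> choice_words A t"
  shows "\<exists>bs. q = concat bs \<and> set bs \<subseteq> (\<Union>x. A x) \<and> length bs \<le> Suc (size t) \<and>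
    q \<in> choice_words (\<lambda>x. A x \<inter> set bs) t"
  using assms
proof (induction t arbitrary: q)
  case (Var x)
  then show ?case by (intro exI[of _ "[q]"]) auto
next
  case (Plus s t)
  then consider "q \<in> choice_words A s" | "q \<in> choice_words A t" by auto
  then show ?case
  proof cases
    case 1
    from Plus.IH(1)[OF this] show ?thesis by force
  next
    case 2
    from Plus.IH(2)[OF this] show ?thesis by force
  qed
next
  case (Times s t)
  then obtain u v where q: "q = u @ v" "u \<in> choice_words A s" "v \<in> choice_words A t" by auto
  obtain bs where bs: "u = concat bs" "set bs \<subseteq> (\<Union>x. A x)" "length bs \<le> Suc (size s)"
      "u \<in> choice_words (\<lambda>x. A x \<inter> set bs) s"
    using Times.IH(1)[OF q(2)] by blast
  obtain cs where cs: "v = concat cs" "set cs \<subseteq> (\<Union>x. A x)" "length cs \<le> Suc (size t)"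
      "v \<in> choice_words (\<lambda>x. A x \<inter> set cs) t"
    using Times.IH(2)[OF q(3)] by blast
  have "u \<in> choice_words (\<lambda>x. A x \<inter> set (bs @ cs)) s" "v \<in> choice_words (\<lambda>x. A x \<inter> set (bs @ cs)) t"
    using bs(4) cs(4) choice_words_mono[of "\<lambda>x. A x \<inter> set bs" "\<lambda>x. A x \<inter> set (bs @ cs)" s]
      choice_words_mono[of "\<lambda>x. A x \<inter> set cs" "\<lambda>x. A x \<inter> set (bs @ cs)" t] by auto
  then show ?case using q(1) bs cs by (intro exI[of _ "bs @ cs"]) auto
qed

section \<open>Evaluation of terms at a point through their words\<close>

lemma EndC_less: "f \<in> EndC m \<Longrightarrow> x < m \<Longrightarrow> f x < m"
  by (simp add: EndC_def)

lemma EndC_mono: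
  assumes "f \<in> EndC m" "x \<le> y" "y < m"
  shows "f x \<le> f y"
proof -
  have "x < m" using assms by simp
  then have "f (max x y) = max (f x) (f y)" using assms unfolding EndC_def by blast
  then show ?thesis using assms(2) by (metis max.absorb2 max.cobounded1)
qed

lemma EndC_outside: "f \<in> EndC m \<Longrightarrow> m \<le> x \<Longrightarrow> f x = 0"
  by (simp add: EndC_def)

lemma EndC_I:
  assumes "\<And>x. x < m \<Longrightarrow> f x < m" "\<And>x y. x \<le> y \<Longrightarrow> y < m \<Longrightarrow> f x \<le> f y" "\<And>x. m \<le> x \<Longrightarrow> f x = 0"
  shows "f \<in> EndC m"
  unfolding EndC_def
proof (intro CollectI conjI allI impI)
  fix x y assume "x < m" "y < m"
  then show "f (max x y) = max (f x) (f y)"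
    using assms(2)[of x y] assms(2)[of y x] by (cases "x \<le> y") (auto simp: max_def)
qed (simp_all add: assms(1,3))

lemma eval_end_EndC:
  assumes "\<And>x. \<rho> x \<in> EndC m"
  shows "eval_end m \<rho> t \<in> EndC m"
proof (induction t)
  case (Plus s t)
  show ?case
    by (rule EndC_I) (auto simp: end_add_def EndC_less[OF Plus(1)] EndC_less[OF Plus(2)]
      intro: max.mono EndC_mono[OF Plus(1)] EndC_mono[OF Plus(2)] simp del: max.bounded_iff)
next
  case (Times s t)
  show ?case
    by (rule EndC_I) (auto simp: end_mult_def EndC_less[OF Times(1)] EndC_less[OF Times(2)]
      intro: EndC_mono[OF Times(2)] EndC_mono[OF Times(1)])
qed (use assms in simp)

lemma eval_end_subst: "eval_end m \<rho> (subst \<sigma> t) = eval_end m (\<lambda>x. eval_end m \<rho> (\<sigma> x)) t"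
  by (induction t) auto

lemma fold_EndC_less:
  assumes "\<And>a. \<rho> a \<in> EndC m" "x < m"
  shows "fold \<rho> q x < m"
  using assms(2) by (induction q arbitrary: x) (auto simp: EndC_less[OF assms(1)])

lemma fold_EndC_mono:
  assumes "\<And>a. \<rho> a \<in> EndC m" "x \<le> y" "y < m"
  shows "fold \<rho> q x \<le> fold \<rho> q y"
  using assms(2,3)
  by (induction q arbitrary: x y) (auto simp: EndC_less[OF assms(1)] EndC_mono[OF assms(1)])

text \<open>Monotonicity carries bounds for single variables through products. Letters are
  interpreted by \<open>\<rho>\<close>, variables by \<open>\<phi>\<close>;
  \<open>fold \<rho> q x\<close> applies the letters of \<open>q\<close> from left to right, as maps
  act on the right.\<close>

lemma eval_end_upper:
  assumes "\<And>a. \<rho> a \<in> EndC m" "\<And>z. \<phi> z \<in> EndC m"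
    and "\<And>z q x. q \<in> A z \<Longrightarrow> x < m \<Longrightarrow> fold \<rho> q x \<le> \<phi> z x"
    and "q \<in> choice_words A t" "x < m"
  shows "fold \<rho> q x \<le> eval_end m \<phi> t x"
  using assms(4,5)
proof (induction t arbitrary: q x)
  case (Var z)
  then show ?case using assms(3) by simp
next
  case (Plus s t)
  then show ?case by (force simp: end_add_def le_max_iff_disj)
next
  case (Times s t)
  then obtain u v where q: "q = u @ v" "u \<in> choice_words A s" "v \<in> choice_words A t" by auto
  have "fold \<rho> v (fold \<rho> u x) \<le> eval_end m \<phi> t (fold \<rho> u x)"
    using Times.IH(2)[OF q(3)] fold_EndC_less[where \<rho>=\<rho>, OF assms(1)] Times.prems(2) by simp
  also have "\<dots> \<le> eval_end m \<phi> t (eval_end m \<phi> s x)"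
  proof (rule EndC_mono[where m=m and f="eval_end m \<phi> t"])
    show "eval_end m \<phi> t \<in> EndC m" by (rule eval_end_EndC) (rule assms(2))
    show "fold \<rho> u x \<le> eval_end m \<phi> s x" using Times.IH(1)[OF q(2)] Times.prems by simp
    have "eval_end m \<phi> s \<in> EndC m" by (rule eval_end_EndC) (rule assms(2))
    then show "eval_end m \<phi> s x < m" using Times.prems EndC_less by simp
  qed
  finally show ?case using q Times.prems by (simp add: end_mult_def)
qed

lemma eval_end_attained:
  assumes "\<And>a. \<rho> a \<in> EndC m" "x < m"
  shows "\<exists>q\<in>words t. fold \<rho> q x = eval_end m \<rho> t x"
  using assms(2)
proof (induction t arbitrary: x)
  case (Plus s t)
  from Plus.IH[OF Plus.prems] show ?case using Plus.prems by (auto simp: end_add_def max_def)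
next
  case (Times s t)
  obtain u where u: "u \<in> words s" "fold \<rho> u x = eval_end m \<rho> s x" using Times by blast
  obtain v where v: "v \<in> words t"
      "fold \<rho> v (eval_end m \<rho> s x) = eval_end m \<rho> t (eval_end m \<rho> s x)"
    using Times.IH(2)[of "eval_end m \<rho> s x"] EndC_less[OF eval_end_EndC[where \<rho>=\<rho>, OF assms(1)] Times.prems]
    by blast
  show ?case using u v Times.prems by (intro bexI[of _ "u @ v"]) (auto simp: end_mult_def)
qed auto

lemma eval_end_words_upper:
  assumes "\<And>a. \<rho> a \<in> EndC m" "q \<in> words t" "x < m"
  shows "fold \<rho> q x \<le> eval_end m \<rho> t x"
  by (rule eval_end_upper[OF assms(1) assms(1) _ assms(2,3)]) auto

lemma holds_in_End_word:
  assumes "holds_in_End m s t" "q \<in> words s" "\<And>a. \<rho> a \<in> EndC m" "x < m"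
  shows "\<exists>p\<in>words t. fold \<rho> q x \<le> fold \<rho> p x"
proof -
  have "eval_end m \<rho> s = eval_end m \<rho> t"
    using assms(1,3) by (simp add: holds_in_End_def)
  moreover have "fold \<rho> q x \<le> eval_end m \<rho> s x"
    by (rule eval_end_words_upper) (use assms in auto)
  moreover have "\<exists>p\<in>words t. fold \<rho> p x = eval_end m \<rho> t x"
    by (rule eval_end_attained) (use assms in auto)
  ultimately show ?thesis by (metis (no_types))
qed

lemma fold_bottom:
  assumes "\<And>a. \<rho> a 0 = (0::nat)"
  shows "fold \<rho> q 0 = 0"
  by (induction q) (auto simp: assms)

text \<open>Some \<open>A z\<close> may be empty; \<open>\<phi> z\<close> is then 0. As all letters
  fix 0, a positive final value never passes through 0, so the values on the way are positive and
  attained by words.\<close>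

lemma eval_end_attained_blocks:
  assumes "\<And>a. \<rho> a 0 = 0" "\<And>z. \<phi> z \<in> EndC m"
    and "\<And>z x. 0 < \<phi> z x \<Longrightarrow> x < m \<Longrightarrow> \<exists>q\<in>A z. fold \<rho> q x = \<phi> z x"
    and "x < m" "0 < eval_end m \<phi> t x"
  shows "\<exists>q\<in>choice_words A t. fold \<rho> q x = eval_end m \<phi> t x"
  using assms(4,5)
proof (induction t arbitrary: x)
  case (Var z)
  then show ?case using assms(3) by simp
next
  case (Plus s t)
  have "\<exists>q\<in>choice_words A s. fold \<rho> q x = eval_end m \<phi> s x" if "0 < eval_end m \<phi> s x"
    using Plus.IH(1)[OF Plus.prems(1) that] .
  moreover have "\<exists>q\<in>choice_words A t. fold \<rho> q x = eval_end m \<phi> t x" if "0 < eval_end m \<phi> t x"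
    using Plus.IH(2)[OF Plus.prems(1) that] .
  moreover have "eval_end m \<phi> (Plus s t) x = eval_end m \<phi> s x \<or> eval_end m \<phi> (Plus s t) x = eval_end m \<phi> t x"
    using Plus.prems by (auto simp: end_add_def max_def)
  ultimately show ?case using Plus.prems(2) unfolding choice_words.simps by fastforce
next
  case (Times s t)
  let ?y = "eval_end m \<phi> s x"
  have y: "?y < m" using EndC_less[OF eval_end_EndC[OF assms(2)] Times.prems(1)] .
  have pos: "0 < eval_end m \<phi> t ?y" using Times.prems by (simp add: end_mult_def)
  obtain v where v: "v \<in> choice_words A t" "fold \<rho> v ?y = eval_end m \<phi> t ?y"
    using Times.IH(2)[OF y pos] by blast
  have "0 < ?y" using v(2) pos fold_bottom[where \<rho>=\<rho> and q=v, OF assms(1)] by (cases "?y = 0") auto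
  then obtain u where u: "u \<in> choice_words A s" "fold \<rho> u x = ?y"
    using Times.IH(1)[OF Times.prems(1)] by blast
  show ?case using u v Times.prems by (intro bexI[of _ "u @ v"]) (auto simp: end_mult_def)
qed

text \<open>The empty word denotes no term; \<open>Var 0\<close> is a filler there.\<close>

fun word_term :: "nat list \<Rightarrow> trm" where
  "word_term [] = Var 0"
| "word_term [x] = Var x"
| "word_term (x # xs) = Times (Var x) (word_term xs)"

lemma words_word_term: "q \<noteq> [] \<Longrightarrow> words (word_term q) = {q}"
  by (induction q rule: word_term.induct) auto

section \<open>The one-element chain\<close>

lemma finite_identity_basis_1: "has_finite_identity_basis 1"
  unfolding has_finite_identity_basis_def
proof (intro exI[of _ "{(Var 0, Var 1)}"] conjI ballI allI impI; clarsimp?)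
  have *: "f = g" if "f \<in> EndC 1" "g \<in> EndC 1" for f g
  proof
    fix x
    show "f x = g x"
      using EndC_less[OF that(1), of 0] EndC_less[OF that(2), of 0]
        EndC_outside[OF that(1), of x] EndC_outside[OF that(2), of x] by (cases "x = 0") auto
  qed
  then show "holds_in_End (Suc 0) (Var 0) (Var (Suc 0))"
    by (simp add: holds_in_End_def)
next
  fix s t
  show "derivable {(Var 0, Var (Suc 0))} s t"
    using derivable.ax[of "Var 0" "Var (Suc 0)" "{(Var 0, Var (Suc 0))}" "\<lambda>x. if x = 0 then s else t"]
    by simp
qed

section \<open>A finite basis for the two-element chain\<close>

text \<open>Besides the laws of idempotent semirings and \<open>xx = x\<close> there are
  \<open>xyx = yx\<close> and two inequalities \<open>a <= b\<close> written as
  \<open>a + b = b\<close>, namely \<open>xty <= xy + zt\<close> and \<open>xy <= x + zxy\<close>.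
  In \<open>EndC 2\<close>, which consists of two constants and the identity, a product is its last
  constant factor, if there is one; all three laws can be read off from this.\<close>

definition basis_2 :: "(trm \<times> trm) set" where
  "basis_2 = (let x = Var 0; y = Var 1; z = Var 2; t = Var 3 in
    {(Plus x (Plus y z), Plus (Plus x y) z),
     (Plus x y, Plus y x),
     (Plus x x, x),
     (Times x (Times y z), Times (Times x y) z),
     (Times x (Plus y z), Plus (Times x y) (Times x z)),
     (Times (Plus x y) z, Plus (Times x z) (Times y z)),
     (Times x x, x),
     (Times x (Times y x), Times y x),
     (Plus (Times x (Times t y)) (Plus (Times x y) (Times z t)), Plus (Times x y) (Times z t)),
     (Plus (Times x y) (Plus x (Times z (Times x y))), Plus x (Times z (Times x y)))})"

abbreviation eqv :: "trm \<Rightarrow> trm \<Rightarrow> bool" (infix "\<approx>" 50) where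
  "s \<approx> t \<equiv> derivable basis_2 s t"

definition below :: "trm \<Rightarrow> trm \<Rightarrow> bool" (infix "\<sqsubseteq>" 50) where
  "s \<sqsubseteq> t \<longleftrightarrow> Plus s t \<approx> t"

lemma basis_2_instances:
  shows plus_assoc: "Plus a (Plus b c) \<approx> Plus (Plus a b) c"
    and plus_comm: "Plus a b \<approx> Plus b a"
    and plus_idem: "Plus a a \<approx> a"
    and times_assoc: "Times a (Times b c) \<approx> Times (Times a b) c"
    and distrib_left: "Times a (Plus b c) \<approx> Plus (Times a b) (Times a c)"
    and distrib_right: "Times (Plus a b) c \<approx> Plus (Times a c) (Times b c)"
    and times_idem: "Times a a \<approx> a"
    and times_absorb: "Times a (Times b a) \<approx> Times b a"
    and insert_below: "Times a (Times d b) \<sqsubseteq> Plus (Times a b) (Times c d)"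
    and cancel_below: "Times a b \<sqsubseteq> Plus a (Times c (Times a b))"
proof -
  define D where "D = derivable basis_2"
  \<comment> \<open>The substitution \<open>(!) [a, b, c, d]\<close> sends \<open>Var 0\<close>,
    ..., \<open>Var 3\<close> to \<open>a\<close>, ..., \<open>d\<close>.\<close>
  have "\<forall>e\<in>basis_2. D (subst ((!) [a, b, c, d]) (fst e)) (subst ((!) [a, b, c, d]) (snd e))"
    unfolding D_def using derivable.ax by (metis prod.collapse)
  note * = this[unfolded basis_2_def Let_def, simplified]
  show "Plus a (Plus b c) \<approx> Plus (Plus a b) c" "Plus a b \<approx> Plus b a" "Plus a a \<approx> a"
    "Times a (Times b c) \<approx> Times (Times a b) c"
    "Times a (Plus b c) \<approx> Plus (Times a b) (Times a c)"
    "Times (Plus a b) c \<approx> Plus (Times a c) (Times b c)"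
    "Times a a \<approx> a" "Times a (Times b a) \<approx> Times b a"
    "Times a (Times d b) \<sqsubseteq> Plus (Times a b) (Times c d)"
    "Times a b \<sqsubseteq> Plus a (Times c (Times a b))"
    unfolding below_def D_def[symmetric] using * by simp_all
qed

section \<open>Validity of the basis in the two-element chain\<close>

definition const_2 :: "nat \<Rightarrow> nat \<Rightarrow> nat" where
  "const_2 c x = (if x < 2 then c else 0)"

definition id_2 :: "nat \<Rightarrow> nat" where
  "id_2 x = (if x < 2 then x else 0)"

lemma EndC_2 [simp]: "c < 2 \<Longrightarrow> const_2 c \<in> EndC 2" "id_2 \<in> EndC 2"
  by (auto intro!: EndC_I simp: const_2_def id_2_def)

lemma EndC_2_cases:
  assumes "f \<in> EndC 2"
  shows "f = const_2 0 \<or> f = const_2 1 \<or> f = id_2"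
proof -
  have eqI: "f = g" if "g \<in> EndC 2" "f 0 = g 0" "f 1 = g 1" for g
  proof
    fix x :: nat
    consider "x = 0" | "x = 1" | "2 \<le> x" by linarith
    then show "f x = g x" using that EndC_outside[OF assms] EndC_outside[of g 2] by cases auto
  qed
  have "f 0 \<le> f 1" "f 1 < 2" using EndC_mono[OF assms, of 0 1] EndC_less[OF assms, of 1] by auto
  then consider "f 0 = 0" "f 1 = 0" | "f 0 = 0" "f 1 = 1" | "f 0 = 1" "f 1 = 1" by linarith
  then show ?thesis
  proof cases
    case 1
    then show ?thesis by (intro disjI1 eqI) (auto simp: const_2_def)
  next
    case 2
    then have "f = id_2" by (intro eqI) (auto simp: id_2_def)
    then show ?thesis by simp
  next
    case 3
    then show ?thesis by (intro disjI2 disjI1 eqI) (auto simp: const_2_def)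
  qed
qed

lemma EndC_2_tables:
  "end_mult 2 (const_2 0) (const_2 0) = const_2 0" "end_mult 2 (const_2 0) (const_2 1) = const_2 1" "end_mult 2 (const_2 0) id_2 = const_2 0"
  "end_mult 2 (const_2 1) (const_2 0) = const_2 0" "end_mult 2 (const_2 1) (const_2 1) = const_2 1" "end_mult 2 (const_2 1) id_2 = const_2 1"
  "end_mult 2 id_2 (const_2 0) = const_2 0" "end_mult 2 id_2 (const_2 1) = const_2 1" "end_mult 2 id_2 id_2 = id_2"
  "end_add 2 (const_2 0) (const_2 0) = const_2 0" "end_add 2 (const_2 0) (const_2 1) = const_2 1" "end_add 2 (const_2 0) id_2 = id_2"
  "end_add 2 (const_2 1) (const_2 0) = const_2 1" "end_add 2 (const_2 1) (const_2 1) = const_2 1" "end_add 2 (const_2 1) id_2 = const_2 1"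
  "end_add 2 id_2 (const_2 0) = id_2" "end_add 2 id_2 (const_2 1) = const_2 1" "end_add 2 id_2 id_2 = id_2"
  by (auto simp: fun_eq_iff end_mult_def end_add_def const_2_def id_2_def)

lemma basis_2_holds:
  assumes "(s, t) \<in> basis_2"
  shows "holds_in_End 2 s t"
  unfolding holds_in_End_def
proof (intro allI impI)
  fix \<rho> :: "nat \<Rightarrow> nat \<Rightarrow> nat"
  assume "\<forall>x. \<rho> x \<in> EndC 2"
  then have cases: "\<rho> x = const_2 0 \<or> \<rho> x = const_2 1 \<or> \<rho> x = id_2" for x
    using EndC_2_cases by blast
  have "\<forall>(s, t)\<in>basis_2. eval_end 2 \<rho> s = eval_end 2 \<rho> t"
    unfolding basis_2_def Let_def ball_simps prod.case eval_end.simps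
    by (intro conjI TrueI; rule disjE[OF cases[of 0]]; (erule disjE)?;
      rule disjE[OF cases[of 1]]; (erule disjE)?;
      rule disjE[OF cases[of 2]]; (erule disjE)?;
      rule disjE[OF cases[of 3]]; (erule disjE)?; simp only: EndC_2_tables)
  then show "eval_end 2 \<rho> s = eval_end 2 \<rho> t" using assms by blast
qed

section \<open>The derivable order and derivations between words\<close>

lemmas eqv_intros = derivable.refl derivable.cong_plus derivable.cong_times
declare derivable.trans [trans]

lemma below_trans [trans]:
  assumes "a \<sqsubseteq> b" "b \<sqsubseteq> c"
  shows "a \<sqsubseteq> c"
  unfolding below_def
proof -
  have "Plus a c \<approx> Plus a (Plus b c)" by (intro eqv_intros derivable.sym[OF assms(2)[unfolded below_def]])
  also have "\<dots> \<approx> Plus (Plus a b) c" by (rule plus_assoc)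
  also have "\<dots> \<approx> Plus b c" by (intro eqv_intros assms(1)[unfolded below_def])
  also have "\<dots> \<approx> c" by (rule assms(2)[unfolded below_def])
  finally show "Plus a c \<approx> c" .
qed

lemma eqv_below: "a \<approx> b \<Longrightarrow> a \<sqsubseteq> b"
  unfolding below_def by (meson derivable.cong_plus derivable.refl derivable.trans plus_idem)

lemma eqv_below_trans [trans]: "a \<approx> b \<Longrightarrow> b \<sqsubseteq> c \<Longrightarrow> a \<sqsubseteq> c"
  by (rule below_trans[OF eqv_below])

lemma below_eqv_trans [trans]: "a \<sqsubseteq> b \<Longrightarrow> b \<approx> c \<Longrightarrow> a \<sqsubseteq> c"
  by (rule below_trans[OF _ eqv_below])

lemma below_antisym: "a \<sqsubseteq> b \<Longrightarrow> b \<sqsubseteq> a \<Longrightarrow> a \<approx> b"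
  unfolding below_def by (meson derivable.sym derivable.trans plus_comm)

lemma below_plus1: "a \<sqsubseteq> Plus a b"
  unfolding below_def by (meson derivable.cong_plus derivable.refl derivable.trans plus_idem plus_assoc)

lemma below_plus2: "b \<sqsubseteq> Plus a b"
  by (rule below_eqv_trans[OF below_plus1 plus_comm])

lemma plus_below:
  assumes "a \<sqsubseteq> c" "b \<sqsubseteq> c"
  shows "Plus a b \<sqsubseteq> c"
  using assms unfolding below_def
proof -
  assume assms: "Plus a c \<approx> c" "Plus b c \<approx> c"
  have "Plus (Plus a b) c \<approx> Plus a (Plus b c)" by (rule derivable.sym[OF plus_assoc])
  also have "\<dots> \<approx> Plus a c" by (intro eqv_intros assms(2))
  also have "\<dots> \<approx> c" by (rule assms(1))
  finally show "Plus (Plus a b) c \<approx> c" .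
qed

lemma times_mono_right:
  assumes "a \<sqsubseteq> b"
  shows "Times c a \<sqsubseteq> Times c b"
  unfolding below_def
  by (rule derivable.trans[OF derivable.sym[OF distrib_left]])
    (intro eqv_intros assms[unfolded below_def])

lemma times_mono_left:
  assumes "a \<sqsubseteq> b"
  shows "Times a c \<sqsubseteq> Times b c"
  unfolding below_def
  by (rule derivable.trans[OF derivable.sym[OF distrib_right]])
    (intro eqv_intros assms[unfolded below_def])

text \<open>Products are nested to the right as in \<open>word_term\<close>, so that prefixing a
  word is an equality of terms and not merely a derivable identity.\<close>

fun left_mult :: "nat list \<Rightarrow> trm \<Rightarrow> trm" where
  "left_mult [] s = s"
| "left_mult (x # u) s = Times (Var x) (left_mult u s)"

lemma word_term_Cons: "u \<noteq> [] \<Longrightarrow> word_term (x # u) = Times (Var x) (word_term u)"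
  by (cases u) auto

lemma word_term_append: "v \<noteq> [] \<Longrightarrow> word_term (u @ v) = left_mult u (word_term v)"
  by (induction u) (auto simp: word_term_Cons)

lemma left_mult_cong: "s \<approx> t \<Longrightarrow> left_mult u s \<approx> left_mult u t"
  by (induction u) (auto intro: eqv_intros)

lemma left_mult_eqv: "u \<noteq> [] \<Longrightarrow> left_mult u s \<approx> Times (word_term u) s"
proof (induction u rule: word_term.induct)
  case (3 x y u)
  have "left_mult (x # y # u) s \<approx> Times (Var x) (Times (word_term (y # u)) s)"
    using 3 by (auto intro: eqv_intros)
  also have "\<dots> \<approx> Times (word_term (x # y # u)) s" using times_assoc by simp
  finally show ?case .
qed (auto intro: derivable.refl)

lemma word_term_append_eqv:
  "u \<noteq> [] \<Longrightarrow> v \<noteq> [] \<Longrightarrow> word_term (u @ v) \<approx> Times (word_term u) (word_term v)"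
  by (simp add: word_term_append left_mult_eqv)

lemma absorb_first: "Times (Var y) (word_term (y # b)) \<approx> word_term (y # b)"
proof (cases b)
  case Nil
  then show ?thesis using times_idem by simp
next
  case (Cons z c)
  have "Times (Var y) (Times (Var y) (word_term b)) \<approx> Times (Times (Var y) (Var y)) (word_term b)"
    by (rule times_assoc)
  also have "\<dots> \<approx> Times (Var y) (word_term b)" by (intro eqv_intros times_idem)
  finally show ?thesis using Cons by simp
qed

text \<open>If \<open>v = a y b\<close>, then \<open>y (a y) b = (a y) b\<close> by
  \<open>xyx = yx\<close>.\<close>

lemma absorb_letter:
  assumes "y \<in> set v"
  shows "Times (Var y) (word_term v) \<approx> word_term v"
proof -
  obtain a b where v: "v = a @ y # b" using assms by (meson split_list)
  show ?thesis
  proof (cases "a = []")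
    case True
    then show ?thesis using absorb_first v by simp
  next
    case False
    let ?a = "word_term a" and ?b = "word_term (y # b)" and ?y = "Var y"
    have "word_term v \<approx> Times ?a ?b" using word_term_append_eqv[OF False] v by simp
    \<comment> \<open>Doubling the \<open>y\<close> that opens \<open>y # b\<close> detaches a
      factor \<open>a y\<close> to which \<open>xyx = yx\<close> applies.\<close>
    also have "\<dots> \<approx> Times ?a (Times ?y ?b)"
      by (intro eqv_intros derivable.sym[OF absorb_first])
    also have "\<dots> \<approx> Times (Times ?a ?y) ?b" by (rule times_assoc)
    finally have *: "word_term v \<approx> Times (Times ?a ?y) ?b" .
    have "Times ?y (word_term v) \<approx> Times ?y (Times (Times ?a ?y) ?b)"
      by (intro eqv_intros *)
    also have "\<dots> \<approx> Times (Times ?y (Times ?a ?y)) ?b" by (rule times_assoc)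
    also have "\<dots> \<approx> Times (Times ?a ?y) ?b" by (intro eqv_intros times_absorb)
    also have "\<dots> \<approx> word_term v" by (rule derivable.sym[OF *])
    finally show ?thesis .
  qed
qed

lemma absorb_word: "set u \<subseteq> set v \<Longrightarrow> left_mult u (word_term v) \<approx> word_term v"
proof (induction u)
  case (Cons y u)
  have "left_mult (y # u) (word_term v) \<approx> Times (Var y) (word_term v)"
    using Cons by (auto intro: eqv_intros)
  also have "\<dots> \<approx> word_term v" using Cons.prems by (intro absorb_letter) simp
  finally show ?case .
qed (simp add: derivable.refl)

section \<open>Necessary conditions on the words of valid identities\<close>

lemma content_condition:
  assumes "holds_in_End 2 s t" "w \<in> words s"
  shows "\<exists>p\<in>words t. set p \<subseteq> set w"
proof -
  \<comment> \<open>Letters of \<open>w\<close> act as the identity, all others as the constant 0,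
    so 1 survives exactly along words over the letters of \<open>w\<close>.\<close>
  define \<rho> where "\<rho> = (\<lambda>x. if x \<in> set w then id_2 else const_2 0)"
  have id: "set q \<subseteq> set w \<Longrightarrow> fold \<rho> q 1 = 1" for q
    by (induction q) (auto simp: \<rho>_def id_2_def)
  have 0: "fold \<rho> q 0 = 0" for q
    by (rule fold_bottom) (auto simp: \<rho>_def id_2_def const_2_def)
  have content: "0 < fold \<rho> q 1 \<Longrightarrow> set q \<subseteq> set w" for q
  proof (induction q)
    case (Cons a q)
    then show ?case using 0[of q] by (cases "a \<in> set w") (auto simp: \<rho>_def id_2_def const_2_def)
  qed simp
  have "\<exists>p\<in>words t. fold \<rho> w 1 \<le> fold \<rho> p 1"
    by (rule holds_in_End_word[OF assms]) (auto simp: \<rho>_def)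
  then obtain p where p: "p \<in> words t" "fold \<rho> w 1 \<le> fold \<rho> p 1" by blast
  then have "0 < fold \<rho> p 1" using id[of w] by simp
  then show ?thesis using p(1) content by blast
qed

lemma suffix_condition:
  assumes "holds_in_End 2 s t" "a @ y # b \<in> words s" "y \<notin> set b"
  shows "\<exists>u v. u @ y # v \<in> words t \<and> set v \<subseteq> set b"
proof -
  \<comment> \<open>A value 1 reached from 0 must be created by \<open>y\<close> as the last letter
    outside \<open>b\<close>: letters of \<open>b\<close> preserve values, all others reset to
    0.\<close>
  define \<rho> where "\<rho> = (\<lambda>x. if x \<in> set b then id_2 else if x = y then const_2 1 else const_2 0)"
  have EndC: "\<rho> x \<in> EndC 2" for x by (auto simp: \<rho>_def)
  have id: "set q \<subseteq> set b \<Longrightarrow> fold \<rho> q 1 = 1" for q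
    by (induction q) (auto simp: \<rho>_def id_2_def)
  have suffix: "0 < fold \<rho> q 0 \<Longrightarrow> \<exists>u v. q = u @ y # v \<and> set v \<subseteq> set b" for q
  proof (induction q rule: rev_induct)
    case (snoc c q)
    consider "c \<in> set b" | "c \<notin> set b" "c = y" | "c \<notin> set b" "c \<noteq> y" by blast
    then show ?case
    proof cases
      case 1
      then obtain u v where "q = u @ y # v" "set v \<subseteq> set b"
        using snoc by (auto simp: \<rho>_def id_2_def split: if_splits)
      then show ?thesis using 1 by (intro exI[of _ u] exI[of _ "v @ [c]"]) auto
    next
      case 2
      then show ?thesis by (intro exI[of _ q] exI[of _ "[]"]) auto
    next
      case 3
      then show ?thesis using snoc by (auto simp: \<rho>_def const_2_def)
    qed
  qed simp
  obtain p where p: "p \<in> words t" "fold \<rho> (a @ y # b) 0 \<le> fold \<rho> p 0"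
    using holds_in_End_word[where \<rho>=\<rho> and x=0, OF assms(1,2) EndC] by auto
  have "fold \<rho> (a @ y # b) 0 = 1"
    using fold_EndC_less[where \<rho>=\<rho> and m=2 and q=a and x=0] EndC assms(3) id[of b]
    by (simp add: \<rho>_def const_2_def)
  then have "0 < fold \<rho> p 0" using p(2) by simp
  from suffix[OF this] show ?thesis using p(1) by blast
qed

section \<open>From the conditions to derivations\<close>

lemma word_below: "q \<in> words t \<Longrightarrow> word_term q \<sqsubseteq> t"
proof (induction t arbitrary: q)
  case (Var x)
  then show ?case by (auto intro: eqv_below derivable.refl)
next
  case (Plus s t)
  from Plus.prems consider "q \<in> words s" | "q \<in> words t" by auto
  then show ?case
    by cases (rule below_trans[OF Plus.IH(1) below_plus1] below_trans[OF Plus.IH(2) below_plus2],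
      assumption)+
next
  case (Times s t)
  then obtain u v where q: "q = u @ v" "u \<in> words s" "v \<in> words t" by auto
  then have "u \<noteq> []" "v \<noteq> []" using Nil_notin_words by auto
  then have "word_term q \<approx> Times (word_term u) (word_term v)"
    using word_term_append_eqv q by simp
  also have "\<dots> \<sqsubseteq> Times s (word_term v)" by (intro times_mono_left Times.IH q)
  also have "\<dots> \<sqsubseteq> Times s t" by (intro times_mono_right Times.IH q)
  finally show ?case .
qed

text \<open>The suffix grows from the right end, using the suffix condition at each letter without a
  later occurrence. This places only a left multiple of the suffix below \<open>t\<close>; the extra
  factor \<open>u\<close> is removed afterwards.\<close>

lemma suffix_below:
  assumes "holds_in_End 2 s t" "a @ b \<in> words s" "b \<noteq> []"
  shows "\<exists>u. word_term (u @ b) \<sqsubseteq> t"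
  using assms(2,3)
proof (induction b arbitrary: a)
  case (Cons y b)
  note IH = Cons.IH[of "a @ [y]"]
  show ?case
  proof (cases "y \<in> set b")
    case True
    then obtain u where u: "word_term (u @ b) \<sqsubseteq> t" using IH Cons.prems by force
    have b: "b \<noteq> []" using True by auto
    have "word_term (u @ y # b) \<approx> word_term (u @ b)"
      using absorb_letter[OF True] b
      by (simp add: word_term_append word_term_Cons left_mult_cong)
    then show ?thesis using u by (blast intro: eqv_below_trans)
  next
    case False
    then obtain z v where p: "z @ y # v \<in> words t" "set v \<subseteq> set b"
      using suffix_condition[OF assms(1) Cons.prems(1)] by blast
    show ?thesis
    proof (cases "b = []")
      case True
      then show ?thesis using p word_below by auto
    next
      case b: False
      then obtain u where u: "word_term (u @ b) \<sqsubseteq> t" using IH Cons.prems by auto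
      \<comment> \<open>The first summand for \<open>insert_below\<close> will be \<open>x b\<close>
        with \<open>x = u b\<close>; it equals \<open>x\<close> because
        \<open>b b = b\<close>.\<close>
      let ?x = "word_term (u @ b)" and ?y = "word_term b" and ?t = "word_term (y # v)"
      have "Times ?x ?y \<approx> word_term ((u @ b) @ b)"
        by (rule derivable.sym[OF word_term_append_eqv]) (use b in auto)
      also have "\<dots> \<approx> ?x"
        using b absorb_word[of b b] by (simp add: word_term_append left_mult_cong)
      also have "\<dots> \<sqsubseteq> t" by (rule u)
      finally have xy: "Times ?x ?y \<sqsubseteq> t" .
      \<comment> \<open>Some left factor of \<open>y v\<close> is needed; if \<open>z\<close> is
        empty, \<open>y\<close> itself serves because \<open>y y v = y v\<close>.\<close>
      obtain z' where z': "Times z' ?t \<sqsubseteq> t"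
      proof (cases "z = []")
        case True
        have "Times (Var y) ?t \<approx> word_term (z @ y # v)"
          using True absorb_first by simp
        then show ?thesis using that eqv_below_trans[OF _ word_below[OF p(1)]] by blast
      next
        case False
        have "Times (word_term z) ?t \<approx> word_term (z @ y # v)"
          using word_term_append_eqv[OF False] by (simp add: derivable.sym)
        then show ?thesis using that eqv_below_trans[OF _ word_below[OF p(1)]] by blast
      qed
      have vb: "Times (Var y) (left_mult v ?y) \<approx> Times ?t ?y"
        using left_mult_eqv[of "y # v" ?y] by simp
      \<comment> \<open>Here \<open>x y b\<close> becomes \<open>x (y v) b\<close> because
        \<open>v b = b\<close>. Omitting \<open>y v\<close> leaves \<open>x b\<close>, and
        \<open>z' y v\<close> is the other summand.\<close>
      have "word_term ((u @ b) @ y # b) \<approx> Times ?x (Times (Var y) ?y)"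
        using word_term_append_eqv[of "u @ b" "y # b"] b by (simp add: word_term_Cons)
      also have "\<dots> \<approx> Times ?x (Times (Var y) (left_mult v ?y))"
        by (intro eqv_intros derivable.sym[OF absorb_word] p(2))
      also have "\<dots> \<approx> Times ?x (Times ?t ?y)"
        by (rule derivable.cong_times[OF derivable.refl vb])
      also have "\<dots> \<sqsubseteq> Plus (Times ?x ?y) (Times z' ?t)" by (rule insert_below)
      also have "\<dots> \<sqsubseteq> t" by (intro plus_below xy z')
      finally show ?thesis by blast
    qed
  qed
qed simp

text \<open>Both \<open>u w\<close> and a word \<open>p\<close> over the letters of \<open>w\<close>
  are below \<open>t\<close>. As \<open>p w = w\<close>, this gives
  \<open>w <= p + u p w = p + u w <= t\<close>.\<close>

lemma word_below_of_holds:
  assumes "holds_in_End 2 s t" "w \<in> words s"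
  shows "word_term w \<sqsubseteq> t"
proof -
  have w: "w \<noteq> []" using assms(2) Nil_notin_words by auto
  obtain u where u: "word_term (u @ w) \<sqsubseteq> t"
    using suffix_below[of s t "[]" w] assms w by auto
  obtain p where p: "p \<in> words t" "set p \<subseteq> set w" using content_condition[OF assms] by blast
  then have p_ne: "p \<noteq> []" using Nil_notin_words by auto
  show ?thesis
  proof (cases "u = []")
    case True
    then show ?thesis using u by simp
  next
    case False
    let ?p = "word_term p" and ?w = "word_term w" and ?u = "word_term u"
    have pw: "Times ?p ?w \<approx> ?w"
      using absorb_word[OF p(2)] left_mult_eqv[OF p_ne]
      by (meson derivable.sym derivable.trans)
    have "?w \<approx> Times ?p ?w" by (rule derivable.sym[OF pw])
    also have "\<dots> \<sqsubseteq> Plus ?p (Times ?u (Times ?p ?w))" by (rule cancel_below)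
    also have "\<dots> \<approx> Plus ?p (Times ?u ?w)" by (intro eqv_intros pw)
    also have "\<dots> \<approx> Plus ?p (word_term (u @ w))"
      by (intro eqv_intros derivable.sym[OF word_term_append_eqv] False w)
    also have "\<dots> \<sqsubseteq> t" by (intro plus_below word_below p(1) u)
    finally show ?thesis .
  qed
qed

text \<open>The context \<open>C\<close> is general so that the two factors of a product can be
  expanded one after the other, each inside a context formed by the other.\<close>

lemma below_of_words:
  assumes "\<And>a b. a \<approx> b \<Longrightarrow> C a \<approx> C b"
    and "\<And>a b. C a \<sqsubseteq> r \<Longrightarrow> C b \<sqsubseteq> r \<Longrightarrow> C (Plus a b) \<sqsubseteq> r"
    and "\<And>q. q \<in> words s \<Longrightarrow> C (word_term q) \<sqsubseteq> r"
  shows "C s \<sqsubseteq> r"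
  using assms
proof (induction s arbitrary: C)
  case (Var x)
  show ?case using Var.prems(3)[of "[x]"] by simp
next
  case (Plus s t)
  have "C s \<sqsubseteq> r"
    by (rule Plus.IH(1)[of C]) (erule Plus.prems(1), erule (1) Plus.prems(2), simp add: Plus.prems(3))
  moreover have "C t \<sqsubseteq> r"
    by (rule Plus.IH(2)[of C]) (erule Plus.prems(1), erule (1) Plus.prems(2), simp add: Plus.prems(3))
  ultimately show ?case by (rule Plus.prems(2))
next
  case (Times s t)
  show ?case
  proof (rule Times.IH(1)[of "\<lambda>a. C (Times a t)"])
    fix u assume u: "u \<in> words s"
    show "C (Times (word_term u) t) \<sqsubseteq> r"
    proof (rule Times.IH(2)[of "\<lambda>a. C (Times (word_term u) a)"])
      fix v assume v: "v \<in> words t"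
      have "C (Times (word_term u) (word_term v)) \<approx> C (word_term (u @ v))"
        using u v Nil_notin_words
        by (intro Times.prems(1) derivable.sym[OF word_term_append_eqv]) auto
      also have "\<dots> \<sqsubseteq> r" by (rule Times.prems(3)) (use u v in auto)
      finally show "C (Times (word_term u) (word_term v)) \<sqsubseteq> r" .
    next
      fix a b
      assume "C (Times (word_term u) a) \<sqsubseteq> r" "C (Times (word_term u) b) \<sqsubseteq> r"
      then have "C (Plus (Times (word_term u) a) (Times (word_term u) b)) \<sqsubseteq> r"
        by (rule Times.prems(2))
      then show "C (Times (word_term u) (Plus a b)) \<sqsubseteq> r"
        by (rule eqv_below_trans[OF Times.prems(1)[OF distrib_left]])
    next
      fix a b assume "a \<approx> b"
      then show "C (Times (word_term u) a) \<approx> C (Times (word_term u) b)"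
        by (intro Times.prems(1) derivable.cong_times derivable.refl)
    qed
  next
    fix a b
    assume "C (Times a t) \<sqsubseteq> r" "C (Times b t) \<sqsubseteq> r"
    then have "C (Plus (Times a t) (Times b t)) \<sqsubseteq> r" by (rule Times.prems(2))
    then show "C (Times (Plus a b) t) \<sqsubseteq> r"
      by (rule eqv_below_trans[OF Times.prems(1)[OF distrib_right]])
  next
    fix a b assume "a \<approx> b"
    then show "C (Times a t) \<approx> C (Times b t)"
      by (intro Times.prems(1) derivable.cong_times derivable.refl)
  qed
qed

lemma below_of_holds: "holds_in_End 2 s t \<Longrightarrow> s \<sqsubseteq> t"
  by (rule below_of_words[where C = "\<lambda>a. a"]) (auto intro: plus_below word_below_of_holds)

lemma finite_identity_basis_2: "has_finite_identity_basis 2"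
  unfolding has_finite_identity_basis_def
proof (intro exI[of _ basis_2] conjI allI impI ballI)
  show "finite basis_2" by (simp add: basis_2_def Let_def)
next
  fix e assume "e \<in> basis_2"
  then show "case e of (s, t) \<Rightarrow> holds_in_End 2 s t" using basis_2_holds by auto
next
  fix s t assume "holds_in_End 2 s t"
  moreover from this have "holds_in_End 2 t s" by (simp add: holds_in_End_def)
  ultimately show "s \<approx> t" by (intro below_antisym below_of_holds)
qed

section \<open>The chains with at least three elements\<close>

definition powers :: "(nat \<Rightarrow> nat) \<Rightarrow> nat \<Rightarrow> nat list" where
  "powers c l = concat (map (\<lambda>k. replicate (c k) k) [0..<l])"

lemma powers_0 [simp]: "powers c 0 = []"
  by (simp add: powers_def)

lemma powers_Suc: "powers c (Suc l) = powers c l @ replicate (c l) l"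
  by (simp add: powers_def)

lemma powers_1: "powers (\<lambda>_. 1) l = [0..<l]"
  by (induction l) (auto simp: powers_Suc)

lemma count_list_replicate: "count_list (replicate k b) a = (if a = b then k else 0)"
  by (induction k) auto

lemma count_list_powers: "count_list (powers c l) a = (if a < l then c a else 0)"
  by (induction l) (auto simp: powers_Suc count_list_append count_list_replicate)

lemma set_powers: "set (powers c l) \<subseteq> {..<l}"
  by (induction l) (auto simp: powers_Suc)

lemma sorted_powers: "sorted (powers c l)"
  using set_powers[of c] by (induction l) (fastforce simp: powers_Suc sorted_append)+

lemma sorted_eq_powers:
  assumes "sorted q" "set q \<subseteq> {..<l}"
  shows "q = powers (count_list q) l"
proof -
  have "count_list q a = count_list (powers (count_list q) l) a" for a
    using assms(2) by (auto simp: count_list_powers count_list_0_iff)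
  then have "mset q = mset (powers (count_list q) l)"
    by (intro multiset_eqI) (simp add: count_mset)
  then show ?thesis
    using properties_for_sort[OF _ assms(1)] sorted_sort_id[OF sorted_powers] by metis
qed

lemma filter_powers:
  assumes "sorted xs" "distinct xs" "set xs \<subseteq> {..<l}"
  shows "filter (\<lambda>a. a \<in> set xs) (powers c l) = concat (map (\<lambda>k. replicate (c k) k) xs)"
proof -
  have "filter (\<lambda>a. a \<in> set xs) [0..<l] = xs"
    by (rule sorted_distinct_set_unique) (use assms in \<open>auto intro: sorted_wrt_filter\<close>)
  moreover have "filter P (concat (map (\<lambda>k. replicate (c k) k) ys)) =
      concat (map (\<lambda>k. replicate (c k) k) (filter P ys))" for P ys
    by (induction ys) (auto simp: filter_replicate)
  ultimately show ?thesis unfolding powers_def by metis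
qed

text \<open>The letter \<open>t\<^sub>i\<close> of the introduction is encoded as \<^term>\<open>2 * i\<close> and \<open>x\<^sub>i\<close> as
  \<^term>\<open>2 * i + 1\<close>, so that \<open>w\<close> becomes \<^term>\<open>[0..<2 * n + 3]\<close>.\<close>

definition shift_exp :: "nat \<Rightarrow> nat \<Rightarrow> nat" where
  "shift_exp k a = (if a = 2 * k + 1 then 0 else if a + 1 = 2 * k then 2 else 1)"

text \<open>At the ends: for \<open>k = 0\<close> no letter is squared, and for
  \<open>k = n + 1\<close> the letter to be deleted, \<open>2 * n + 3\<close>, lies outside the
  word.\<close>

definition shift_word :: "nat \<Rightarrow> nat \<Rightarrow> nat list" where
  "shift_word n k = powers (shift_exp k) (2 * n + 3)"

section \<open>The inequality between \<open>w\<close> and the sum of the \<open>w_k\<close>\<close>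

lemma shift_words_upper:
  assumes \<rho>: "\<And>a. \<rho> a \<in> EndC m" and x: "x < m"
  shows "\<exists>k\<le>Suc n. fold \<rho> [0..<2 * n + 3] x \<le> fold \<rho> (shift_word n k) x"
proof (rule ccontr)
  \<comment> \<open>\<open>P i\<close> is the position after the first \<open>i\<close> letters of
    \<open>w\<close>, and \<open>Q k i\<close> the one after the same letters with the exponents of
    \<open>w_k\<close>.\<close>
  define P where "P i = fold \<rho> [0..<i] x" for i
  define Q where "Q k i = fold \<rho> (powers (shift_exp k) i) x" for k i
  have P_less: "P i < m" for i unfolding P_def by (rule fold_EndC_less[OF \<rho> x])
  have Q_less: "Q k i < m" for k i unfolding Q_def by (rule fold_EndC_less[OF \<rho> x])
  have P_Suc: "P (Suc i) = \<rho> i (P i)" for i by (simp add: P_def)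
  have Q_Suc: "Q k (Suc i) = (\<rho> i ^^ shift_exp k i) (Q k i)" for k i
    by (simp add: Q_def powers_Suc fold_replicate)
  \<comment> \<open>The exponents agree below the squared letter \<open>2 * k - 1\<close> and again
    above the deleted letter \<open>2 * k + 1\<close>; so if \<open>Q k\<close> is not behind at
    \<open>2 * k + 2\<close>, it is not behind later.\<close>
  have Q_eq: "i < 2 * k \<Longrightarrow> Q k i = P i" for k i
  proof (induction i)
    case (Suc i)
    then show ?case by (simp add: Q_Suc P_Suc shift_exp_def)
  qed (simp add: P_def Q_def)
  have Q_ge: "2 * k + 2 \<le> i \<Longrightarrow> P (2 * k + 2) \<le> Q k (2 * k + 2) \<Longrightarrow> P i \<le> Q k i" for k i
  proof (induction i rule: dec_induct)
    case (step i)
    then show ?case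
      using EndC_mono[OF \<rho>, of "P i" "Q k i" i] Q_less[of k i] by (simp add: Q_Suc P_Suc shift_exp_def)
  qed
  assume no: "\<not> ?thesis"
  have less: "Q k (2 * n + 3) < P (2 * n + 3)" if "k \<le> Suc n" for k
  proof -
    have "\<not> fold \<rho> [0..<2 * n + 3] x \<le> fold \<rho> (shift_word n k) x"
      using no that by blast
    then show ?thesis by (simp add: shift_word_def P_def Q_def)
  qed
  \<comment> \<open>If \<open>x_(k-1)\<close> moves the trajectory up, then by monotonicity applying
    it once more does not lead below the point reached; so \<open>Q k\<close> is not behind just
    before \<open>x_k\<close>.\<close>
  have P_Q: "P (2 * k + 1) \<le> Q k (2 * k + 1)" if "k = 0 \<or> P (2 * k - 1) < P (2 * k)" for k
  proof (cases k)
    case 0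
    then show ?thesis by (simp add: Q_Suc P_Suc shift_exp_def) (simp add: P_def Q_def)
  next
    case (Suc j)
    have "P (2 * k) = \<rho> (2 * k - 1) (P (2 * k - 1))" using P_Suc[of "2 * k - 1"] Suc by simp
    also have "\<dots> \<le> \<rho> (2 * k - 1) (P (2 * k))"
      using that Suc by (intro EndC_mono[OF \<rho>] P_less) auto
    also have "\<dots> = Q k (2 * k)"
      using Q_Suc[of k "2 * k - 1"] Q_eq[of "2 * k - 1" k] P_Suc[of "2 * k - 1"] Suc
      by (simp add: shift_exp_def numeral_2_eq_2)
    finally have "P (2 * k) \<le> Q k (2 * k)" .
    then have "\<rho> (2 * k) (P (2 * k)) \<le> \<rho> (2 * k) (Q k (2 * k))"
      by (intro EndC_mono[OF \<rho>] Q_less)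
    then show ?thesis by (simp add: Q_Suc P_Suc shift_exp_def)
  qed
  \<comment> \<open>If \<open>x_k\<close> did not move up, deleting it would cost nothing, and
    \<open>w_k\<close> would end at least as high as \<open>w\<close>.\<close>
  have increasing: "k \<le> n \<Longrightarrow> P (2 * k + 1) < P (2 * k + 2)" for k
  proof (induction k)
    case 0
    show ?case
    proof (rule ccontr)
      assume "\<not> ?thesis"
      then have "P (2 * 0 + 2) \<le> Q 0 (2 * 0 + 2)"
        using P_Q[of 0] Q_Suc[of 0 1] by (simp add: shift_exp_def numeral_2_eq_2)
      from Q_ge[OF _ this, of "2 * n + 3"] less[of 0] show False by simp
    qed
  next
    case (Suc k)
    show ?case
    proof (rule ccontr)
      assume "\<not> ?thesis"
      then have "P (2 * Suc k + 2) \<le> Q (Suc k) (2 * Suc k + 2)"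
        using P_Q[of "Suc k"] Q_Suc[of "Suc k" "2 * Suc k + 1"] Suc by (simp add: shift_exp_def)
      from Q_ge[OF _ this, of "2 * n + 3"] less[of "Suc k"] Suc.prems show False by simp
    qed
  qed
  \<comment> \<open>For \<open>k = n + 1\<close> nothing is deleted, and
    \<open>2 * Suc n + 1\<close> is already the full length.\<close>
  have "P (2 * Suc n + 1) \<le> Q (Suc n) (2 * Suc n + 1)"
    using P_Q[of "Suc n"] increasing[of n] by simp
  then show False using less[of "Suc n"] by (simp add: numeral_3_eq_3)
qed

section \<open>The shape of the words below the sum of the \<open>w_k\<close>\<close>

text \<open>In \<open>EndC m\<close> this says \<open>q <= w_0 + ... + w_(n+1)\<close>; the witness
  \<open>k\<close> may depend on the assignment and the point.\<close>

definition dominated :: "nat \<Rightarrow> nat \<Rightarrow> nat list \<Rightarrow> bool" where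
  "dominated m n q \<longleftrightarrow> (\<forall>\<rho> x. (\<forall>a. \<rho> a \<in> EndC m) \<longrightarrow> x < m \<longrightarrow>
    (\<exists>k\<le>Suc n. fold \<rho> q x \<le> fold \<rho> (shift_word n k) x))"

text \<open>All points of the chain from 2 upwards are sent to \<open>c\<close>, which simulates the
  three-element chain inside a longer one; \<open>tri m 0 1 2\<close> fixes 0, 1 and 2.\<close>

definition tri :: "nat \<Rightarrow> nat \<Rightarrow> nat \<Rightarrow> nat \<Rightarrow> nat \<Rightarrow> nat" where
  "tri m a b c x = (if m \<le> x then 0 else if x = 0 then a else if x = 1 then b else c)"

lemma tri_EndC: "a \<le> b \<Longrightarrow> b \<le> c \<Longrightarrow> c \<le> 2 \<Longrightarrow> 3 \<le> m \<Longrightarrow> tri m a b c \<in> EndC m"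
  by (rule EndC_I) (auto simp: tri_def)

lemma tri_simps [simp]:
  assumes "3 \<le> m"
  shows "tri m a b c 0 = a" "tri m a b c (Suc 0) = b" "tri m a b c 2 = c"
  using assms by (auto simp: tri_def)

lemma fold_filter_id:
  assumes m: "3 \<le> m" and \<rho>: "\<And>a. a \<notin> J \<Longrightarrow> \<rho> a = tri m 0 1 2"
    and le2: "\<And>a y. y \<le> 2 \<Longrightarrow> \<rho> a y \<le> 2" and x: "x \<le> 2"
  shows "fold \<rho> q x = fold \<rho> (filter (\<lambda>a. a \<in> J) q) x"
  using x
proof (induction q arbitrary: x)
  case (Cons a q)
  have "tri m 0 1 2 x = x" using Cons.prems m by (auto simp: tri_def)
  then show ?case using Cons le2 \<rho> by (cases "a \<in> J") auto
qed simp

text \<open>Letters outside \<open>J\<close> fix 0, 1 and 2, so such an assignment tests only the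
  letters in \<open>J\<close>.\<close>

definition sparse :: "nat \<Rightarrow> (nat \<Rightarrow> nat \<Rightarrow> nat) \<Rightarrow> nat set \<Rightarrow> bool" where
  "sparse m \<rho> J \<longleftrightarrow> (\<forall>a. a \<notin> J \<longrightarrow> \<rho> a = tri m 0 1 2) \<and>
    (\<forall>a. \<exists>i j k. i \<le> j \<and> j \<le> k \<and> k \<le> 2 \<and> \<rho> a = tri m i j k)"

lemma dominated_sparse:
  assumes "dominated m n q" "3 \<le> m" "sparse m \<rho> J" "x \<le> 2"
  shows "\<exists>k\<le>Suc n. fold \<rho> (filter (\<lambda>a. a \<in> J) q) x \<le> fold \<rho> (filter (\<lambda>a. a \<in> J) (shift_word n k)) x"
proof -
  have tri: "\<exists>i j k. i \<le> j \<and> j \<le> k \<and> k \<le> 2 \<and> \<rho> a = tri m i j k" for a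
    using assms(3) by (simp add: sparse_def)
  have EndC: "\<rho> a \<in> EndC m" for a
    using tri[of a] tri_EndC[OF _ _ _ assms(2)] by auto
  have "\<rho> a y \<le> 2" for a y
  proof -
    obtain i j k where "i \<le> j" "j \<le> k" "k \<le> 2" "\<rho> a = tri m i j k" using tri[of a] by blast
    then show ?thesis by (simp add: tri_def)
  qed
  then have "fold \<rho> p x = fold \<rho> (filter (\<lambda>a. a \<in> J) p) x" for p
    using assms(2-4) by (intro fold_filter_id) (auto simp: sparse_def)
  moreover have x: "x < m" using assms(2,4) by simp
  obtain k where "k \<le> Suc n" "fold \<rho> q x \<le> fold \<rho> (shift_word n k) x"
    using assms(1,2,4) EndC x unfolding dominated_def by blast
  ultimately show ?thesis by auto
qed


lemma sparse_empty: "sparse m (\<lambda>_. tri m 0 1 2) {}"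
  unfolding sparse_def by (intro conjI allI impI exI[of _ 0] exI[of _ 1] exI[of _ 2]) auto

lemma sparse_upd:
  assumes "sparse m \<rho> J" "i \<le> j" "j \<le> k" "k \<le> 2"
  shows "sparse m (\<rho>(a := tri m i j k)) (insert a J)"
  using assms unfolding sparse_def by (metis fun_upd_apply insertCI)

lemma filter_shift_word:
  assumes "sorted xs" "distinct xs" "set xs \<subseteq> {..<2 * n + 3}"
  shows "filter (\<lambda>a. a \<in> set xs) (shift_word n k) = concat (map (\<lambda>a. replicate (shift_exp k a) a) xs)"
  unfolding shift_word_def by (rule filter_powers[OF assms])

lemma shift_exp_even: "even a \<Longrightarrow> shift_exp k a = 1"
  by (auto simp: shift_exp_def) presburger

lemma filter_eq_replicate: "filter (\<lambda>b. b = a) q = replicate (count_list q a) a"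
  by (induction q) auto

lemma funpow_fixed: "f x = x \<Longrightarrow> (f ^^ k) x = x"
  by (induction k) auto

text \<open>A letter foreign to all \<open>w_k\<close> can be sent to the constant 2, which lifts 0
  in \<open>q\<close> only.\<close>

lemma dominated_letters:
  assumes "dominated m n q" "3 \<le> m"
  shows "set q \<subseteq> {..<2 * n + 3}"
proof (rule subsetI, rule ccontr)
  fix a assume a: "a \<in> set q" "a \<notin> {..<2 * n + 3}"
  define \<rho> where "\<rho> = (\<lambda>_. tri m 0 1 2)(a := tri m 2 2 2)"
  have "sparse m \<rho> {a}" unfolding \<rho>_def by (intro sparse_upd sparse_empty) auto
  from dominated_sparse[OF assms this, of 0] obtain k where
    k: "fold \<rho> (filter (\<lambda>b. b = a) q) 0 \<le> fold \<rho> (filter (\<lambda>b. b = a) (shift_word n k)) 0"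
    by auto
  have "filter (\<lambda>b. b = a) (shift_word n k) = []"
    using a(2) set_powers[of "shift_exp k" "2 * n + 3"] by (auto simp: shift_word_def filter_empty_conv)
  moreover obtain j where "count_list q a = Suc j"
    using a(1) by (metis count_list_0_iff not0_implies_Suc)
  moreover have "(tri m 2 2 2 ^^ j) 2 = 2" by (rule funpow_fixed) (use assms(2) in simp)
  ultimately show False
    using k assms(2) by (simp add: filter_eq_replicate fold_replicate funpow_swap1 \<rho>_def)
qed

text \<open>Each \<open>w_k\<close> contains every \<open>t_i\<close> exactly once. Sending
  \<open>t_i\<close> to the constant 0 excludes its absence from \<open>q\<close>, and the map 0 ->
  1 -> 2 excludes repetition.\<close>

lemma dominated_count_even:
  assumes "dominated m n q" "3 \<le> m" "even a" "a < 2 * n + 3"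
  shows "count_list q a = 1"
proof (rule ccontr)
  have word: "filter (\<lambda>b. b = a) (shift_word n k) = [a]" for k
    using filter_shift_word[of "[a]" n k] assms(3,4) by (simp add: shift_exp_even)
  have *: "fold \<rho> (replicate (count_list q a) a) x \<le> \<rho> a x"
    if "\<rho> = (\<lambda>_. tri m 0 1 2)(a := tri m i j k)" "i \<le> j" "j \<le> k" "k \<le> 2" "x \<le> 2" for \<rho> i j k x
  proof -
    have "sparse m \<rho> {a}" unfolding that(1) by (intro sparse_upd sparse_empty that)
    from dominated_sparse[OF assms(1,2) this that(5)] show ?thesis
      by (simp add: filter_eq_replicate[symmetric] word)
  qed
  assume "count_list q a \<noteq> 1"
  then consider "count_list q a = 0" | j where "count_list q a = Suc (Suc j)"
    by (metis One_nat_def not0_implies_Suc)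
  then show False
  proof cases
    case 1
    then show False using *[OF HOL.refl, of 0 0 0 2] assms(2) by simp
  next
    case (2 j)
    have "(tri m 1 2 2 ^^ j) 2 = 2" by (rule funpow_fixed) (use assms(2) in simp)
    then show False using *[OF HOL.refl, of 1 2 2 0] assms(2) 2 by (simp add: fold_replicate funpow_swap1)
  qed
qed

lemma fold_invariant_set:
  assumes "\<And>a y. a \<in> set q \<Longrightarrow> y \<in> S \<Longrightarrow> \<rho> a y \<in> S" "y \<in> S"
  shows "fold \<rho> q y \<in> S"
  using assms by (induction q arbitrary: y) auto

text \<open>All \<open>w_k\<close> list \<open>a\<close> before \<open>b\<close>, and the even
  letter of the two occurs in each of them; the maps are chosen so that only the reverse order
  reaches a high value.\<close>

lemma dominated_no_inversion:
  assumes "dominated m n (u @ b # v)" "3 \<le> m" "a \<in> set v" "a < b" "even a \<or> even b"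
  shows False
proof -
  have b: "b < 2 * n + 3" using dominated_letters[OF assms(1,2)] by auto
  have word: "filter (\<lambda>c. c \<in> {a, b}) (shift_word n k) =
      replicate (shift_exp k a) a @ replicate (shift_exp k b) b" for k
    using filter_shift_word[of "[a, b]" n k] assms(4) b by simp
  show False
  proof (cases "even a")
    case True
    have "count_list u a + count_list v a = 1"
      using dominated_count_even[OF assms(1,2) True] assms(4) b by (simp add: count_list_append)
    moreover have "count_list v a \<noteq> 0" using assms(3) by (simp add: count_list_0_iff)
    ultimately have "a \<notin> set u" by (simp add: count_list_0_iff[symmetric])
    \<comment> \<open>From 1, an \<open>a\<close> that comes first leads to 0 for ever, whereas
      \<open>b\<close> first lifts to 2, which \<open>a\<close> keeps.\<close>
    define \<rho> where "\<rho> = (\<lambda>_. tri m 0 1 2)(b := tri m 0 2 2, a := tri m 0 0 2)"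
    have "sparse m \<rho> {a, b}" unfolding \<rho>_def by (intro sparse_upd sparse_empty) auto
    from dominated_sparse[OF assms(1,2) this, of 1] obtain k where k:
      "fold \<rho> (filter (\<lambda>c. c \<in> {a, b}) (u @ b # v)) 1 \<le> fold \<rho> (filter (\<lambda>c. c \<in> {a, b}) (shift_word n k)) 1"
      by auto
    have "fold \<rho> (filter (\<lambda>c. c \<in> {a, b}) u) 1 \<in> {1, 2}"
      by (rule fold_invariant_set) (use \<open>a \<notin> set u\<close> assms(2,4) in \<open>auto simp: \<rho>_def\<close>)
    then have "\<rho> b (fold \<rho> (filter (\<lambda>c. c \<in> {a, b}) u) 1) = 2"
      using assms(2,4) by (auto simp: \<rho>_def)
    moreover have "fold \<rho> (filter (\<lambda>c. c \<in> {a, b}) v) 2 \<in> {2}"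
      by (rule fold_invariant_set) (use assms(2,4) in \<open>auto simp: \<rho>_def\<close>)
    ultimately have "fold \<rho> (filter (\<lambda>c. c \<in> {a, b}) (u @ b # v)) 1 = 2" by simp
    moreover have "fold \<rho> (filter (\<lambda>c. c \<in> {a, b}) (shift_word n k)) 1 = 0"
      unfolding word using assms(2,4)
      by (simp add: shift_exp_even[OF True] fold_replicate funpow_fixed \<rho>_def)
    ultimately show False using k by simp
  next
    case False
    then have even: "even b" using assms(5) by simp
    have "b \<notin> set v"
      using dominated_count_even[OF assms(1,2) even b] by (simp add: count_list_append count_list_0_iff)
    then have v: "filter (\<lambda>c. c \<in> {a, b}) v = replicate (count_list v a) a"
      unfolding filter_eq_replicate[symmetric] by (intro filter_cong) auto
    obtain j where j: "count_list v a = Suc j"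
      using assms(3) by (metis count_list_0_iff not0_implies_Suc)
    \<comment> \<open>Here \<open>b\<close> resets to 0 and a later \<open>a\<close> lifts 0 to 1;
      among the two letters, \<open>b\<close> comes last in every \<open>w_k\<close>.\<close>
    define \<rho> where "\<rho> = (\<lambda>_. tri m 0 1 2)(b := tri m 0 0 0, a := tri m 1 1 2)"
    have "sparse m \<rho> {a, b}" unfolding \<rho>_def by (intro sparse_upd sparse_empty) auto
    from dominated_sparse[OF assms(1,2) this, of 0] obtain k where k:
      "fold \<rho> (filter (\<lambda>c. c \<in> {a, b}) (u @ b # v)) 0 \<le> fold \<rho> (filter (\<lambda>c. c \<in> {a, b}) (shift_word n k)) 0"
      by auto
    have \<rho>_b: "\<rho> b y = 0" for y using assms(4) by (simp add: \<rho>_def tri_def)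
    have "fold \<rho> (replicate (Suc j) a) 0 = 1"
      using assms(2) by (simp add: fold_replicate funpow_fixed \<rho>_def)
    then have "fold \<rho> (filter (\<lambda>c. c \<in> {a, b}) (u @ b # v)) 0 = 1"
      using v j \<rho>_b by simp
    moreover have "fold \<rho> (filter (\<lambda>c. c \<in> {a, b}) (shift_word n k)) 0 = 0"
      unfolding word by (simp add: shift_exp_even[OF even] \<rho>_b)
    ultimately show False using k by simp
  qed
qed

lemma not_sorted_inversion:
  fixes q :: "'a :: linorder list"
  assumes "\<not> sorted q"
  shows "\<exists>u b v a. q = u @ b # v \<and> a \<in> set v \<and> a < b"
  using assms
proof (induction q)
  case (Cons c q)
  show ?case
  proof (cases "sorted q")
    case True
    then obtain a where "a \<in> set q" "a < c" using Cons.prems by (auto simp: not_le)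
    then show ?thesis by (metis append_Nil)
  next
    case False
    then show ?thesis using Cons.IH by (metis append_Cons)
  qed
qed simp

text \<open>Between two odd letters \<open>a < b\<close> lies the even letter \<open>a + 1\<close>.
  It occurs in \<open>q\<close>, and wherever it stands it forms a forbidden inversion with
  \<open>a\<close> or \<open>b\<close>.\<close>

lemma dominated_sorted:
  assumes "dominated m n q" "3 \<le> m"
  shows "sorted q"
proof (rule ccontr)
  assume "\<not> sorted q"
  then obtain u b v a where q: "q = u @ b # v" "a \<in> set v" "a < b"
    using not_sorted_inversion by blast
  then have odd: "odd a" "odd b"
    using dominated_no_inversion[of m n u b v a] assms by auto
  then have "Suc a < b" using q(3) by (metis Suc_lessI even_Suc)
  moreover have "b < 2 * n + 3" using dominated_letters[OF assms] q(1) by auto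
  ultimately have "count_list q (Suc a) = 1"
    using odd(1) by (intro dominated_count_even[OF assms]) auto
  then have "Suc a \<in> set q" by (metis count_list_0_iff zero_neq_one)
  then consider "Suc a \<in> set v" | "Suc a \<in> set u" using q(1) \<open>Suc a < b\<close> by auto
  then show False
  proof cases
    case 1
    then show False
      using dominated_no_inversion[of m n u b v "Suc a"] assms q(1) odd(1) \<open>Suc a < b\<close> by auto
  next
    case 2
    then obtain u1 u2 where "u = u1 @ Suc a # u2" by (meson split_list)
    then show False
      using dominated_no_inversion[of m n u1 "Suc a" "u2 @ b # v" a] assms q odd(1) by auto
  qed
qed

lemma dominated_eq_powers:
  assumes "dominated m n q" "3 \<le> m"
  shows "q = powers (count_list q) (2 * n + 3)"
  using sorted_eq_powers dominated_sorted[OF assms] dominated_letters[OF assms] by blast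

lemma replicate_2: "replicate 2 a = [a, a]"
  by (simp add: numeral_2_eq_2)

lemma filter_dominated:
  assumes "dominated m n q" "3 \<le> m" "sorted xs" "distinct xs" "set xs \<subseteq> {..<2 * n + 3}"
  shows "filter (\<lambda>a. a \<in> set xs) q = concat (map (\<lambda>a. replicate (count_list q a) a) xs)"
  using filter_powers[OF assms(3-5), of "count_list q"] dominated_eq_powers[OF assms(1,2)] by simp

text \<open>The only \<open>w_k\<close> without \<open>x_(d+1)\<close> is the one that squares
  \<open>x_d\<close>. With \<open>x_d\<close> acting as 2 -> 1 -> 0 and \<open>x_(d+1)\<close> as
  the constant 0, every \<open>w_k\<close> takes 2 to 0, but a word with at most one
  \<open>x_d\<close> and no \<open>x_(d+1)\<close> does not.\<close>

lemma dominated_no_deletion: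
  assumes "dominated m n q" "3 \<le> m" "Suc d \<le> n" "count_list q (2 * d + 1) \<le> 1"
  shows "count_list q (2 * d + 3) \<noteq> 0"
proof
  assume no: "count_list q (2 * d + 3) = 0"
  let ?J = "{2 * d + 3, 2 * d + 1}"
  have J: "?J = set [2 * d + 1, 2 * d + 3]" by auto
  define \<rho> where "\<rho> = (\<lambda>_. tri m 0 1 2)(2 * d + 1 := tri m 0 0 1, 2 * d + 3 := tri m 0 0 0)"
  have "sparse m \<rho> ?J" unfolding \<rho>_def by (intro sparse_upd sparse_empty) auto
  from dominated_sparse[OF assms(1,2) this, of 2] obtain k where k:
    "fold \<rho> (filter (\<lambda>c. c \<in> ?J) q) 2 \<le> fold \<rho> (filter (\<lambda>c. c \<in> ?J) (shift_word n k)) 2"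
    by auto
  have "filter (\<lambda>c. c \<in> ?J) q = replicate (count_list q (2 * d + 1)) (2 * d + 1)"
    using filter_dominated[OF assms(1,2), of "[2 * d + 1, 2 * d + 3]"] assms(3) no unfolding J by simp
  moreover have "count_list q (2 * d + 1) = 0 \<or> count_list q (2 * d + 1) = 1" using assms(4) by linarith
  ultimately have "0 < fold \<rho> (filter (\<lambda>c. c \<in> ?J) q) 2"
    using assms(2) by (auto simp: \<rho>_def)
  moreover have word: "filter (\<lambda>c. c \<in> ?J) (shift_word n k) =
    replicate (shift_exp k (2 * d + 1)) (2 * d + 1) @ replicate (shift_exp k (2 * d + 3)) (2 * d + 3)"
    unfolding J by (subst filter_shift_word) (use assms(3) in auto)
  moreover have "fold \<rho> (replicate (shift_exp k (2 * d + 1)) (2 * d + 1) @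
      replicate (shift_exp k (2 * d + 3)) (2 * d + 3)) 2 = 0"
  proof (cases "k = Suc d")
    case True
    then show ?thesis using assms(2) by (simp add: shift_exp_def replicate_2 \<rho>_def)
  next
    case False
    then have "shift_exp k (2 * d + 3) \<noteq> 0" by (simp add: shift_exp_def)
    then obtain j where "shift_exp k (2 * d + 3) = Suc j" using not0_implies_Suc by blast
    moreover have "\<rho> (2 * d + 3) y = 0" for y by (simp add: \<rho>_def tri_def)
    ultimately show ?thesis by (simp only: fold_append fold_replicate funpow.simps comp_apply)
  qed
  ultimately show False using k by simp
qed

text \<open>The only \<open>w_k\<close> that squares \<open>x_d\<close> lacks
  \<open>x_(d+1)\<close>. Two \<open>x_d\<close> are made necessary to get from 0 to 2,
  \<open>t_(d+1)\<close> lowers 2 to 1 and the rest to 0, and only \<open>x_(d+1)\<close> leads from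
  1 back to 2.\<close>

lemma dominated_no_square:
  assumes "dominated m n q" "3 \<le> m" "Suc d \<le> n" "1 \<le> count_list q (2 * d + 3)"
  shows "count_list q (2 * d + 1) \<le> 1"
proof (rule ccontr)
  assume no: "\<not> ?thesis"
  let ?J = "{2 * d + 3, 2 * d + 2, 2 * d + 1}"
  have J: "?J = set [2 * d + 1, 2 * d + 2, 2 * d + 3]" by auto
  define \<rho> where "\<rho> = (\<lambda>_. tri m 0 1 2)
    (2 * d + 1 := tri m 1 2 2, 2 * d + 2 := tri m 0 0 1, 2 * d + 3 := tri m 0 2 2)"
  have "sparse m \<rho> ?J" unfolding \<rho>_def by (intro sparse_upd sparse_empty) auto
  from dominated_sparse[OF assms(1,2) this, of 0] obtain k where k:
    "fold \<rho> (filter (\<lambda>c. c \<in> ?J) q) 0 \<le> fold \<rho> (filter (\<lambda>c. c \<in> ?J) (shift_word n k)) 0"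
    by auto
  have even: "count_list q (2 * d + 2) = 1"
    by (rule dominated_count_even[OF assms(1,2)]) (use assms(3) in auto)
  have q: "filter (\<lambda>c. c \<in> ?J) q = replicate (count_list q (2 * d + 1)) (2 * d + 1) @
      [2 * d + 2] @ replicate (count_list q (2 * d + 3)) (2 * d + 3)"
    using filter_dominated[OF assms(1,2), of "[2 * d + 1, 2 * d + 2, 2 * d + 3]"] assms(3) even
    unfolding J by simp
  obtain i j where ij: "count_list q (2 * d + 1) = Suc (Suc i)" "count_list q (2 * d + 3) = Suc j"
    using no assms(4) by (metis One_nat_def Suc_le_D not_less_eq_eq)
  have "fold \<rho> (filter (\<lambda>c. c \<in> ?J) q) 0 = 2"
    unfolding q ij using assms(2) by (simp add: fold_replicate funpow_fixed funpow_swap1 \<rho>_def)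
  moreover have word: "filter (\<lambda>c. c \<in> ?J) (shift_word n k) =
      replicate (shift_exp k (2 * d + 1)) (2 * d + 1) @ [2 * d + 2] @
      replicate (shift_exp k (2 * d + 3)) (2 * d + 3)"
    unfolding J by (subst filter_shift_word) (use assms(3) in \<open>auto simp: shift_exp_even\<close>)
  moreover consider "shift_exp k (2 * d + 1) = 2" "shift_exp k (2 * d + 3) = 0" |
      "shift_exp k (2 * d + 1) \<le> 1"
    using that by (cases "k = Suc d") (auto simp: shift_exp_def)
  then have "fold \<rho> (replicate (shift_exp k (2 * d + 1)) (2 * d + 1) @ [2 * d + 2] @
      replicate (shift_exp k (2 * d + 3)) (2 * d + 3)) 0 \<le> 1"
  proof cases
    case 1
    then show ?thesis using assms(2) by (simp add: \<rho>_def replicate_2)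
  next
    case 2
    then have "shift_exp k (2 * d + 1) = 0 \<or> shift_exp k (2 * d + 1) = 1" by linarith
    then show ?thesis using assms(2) by (auto simp: fold_replicate funpow_fixed \<rho>_def)
  qed
  ultimately show False using k by simp
qed

section \<open>The colouring that isolates \<open>x_r\<close>\<close>

text \<open>The letters \<open>x_0\<close>, ..., \<open>x_r\<close> and \<open>t_(r+2)\<close>,
  \<open>t_(r+3)\<close>, ... go up, \<open>t_1\<close>, ..., \<open>t_r\<close> and
  \<open>x_(r+1)\<close>, \<open>x_(r+2)\<close>, ... go down, \<open>t_0\<close> and
  \<open>t_(r+1)\<close> rest. Along \<open>w\<close> the point 1 moves between 1 and 2; the value 0
  is a trap.\<close>

definition colour :: "nat \<Rightarrow> nat \<Rightarrow> nat \<Rightarrow> nat \<Rightarrow> nat" where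
  "colour m r a = (if a = 0 \<or> a = 2 * r + 2 then tri m 0 1 2
    else if (a < 2 * r + 2) = odd a then tri m 0 2 2 else tri m 0 0 1)"

lemma colour_EndC: "3 \<le> m \<Longrightarrow> colour m r a \<in> EndC m"
  by (auto simp: colour_def intro: tri_EndC)

lemma colour_0: "3 \<le> m \<Longrightarrow> colour m r a 0 = 0"
  by (simp add: colour_def)

lemma colour_le_2: "colour m r a x \<le> 2"
  by (simp add: colour_def tri_def)

lemma colour_target:
  assumes "3 \<le> m" "r \<le> n"
  shows "fold (colour m r) [0..<2 * n + 3] 1 = 2"
proof -
  \<comment> \<open>Up to \<open>i = 2 * r + 2\<close> the value is 2 at positive even
    \<open>i\<close>, afterwards at odd \<open>i\<close>: the resting letter \<open>t_(r+1)\<close>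
    switches the parity.\<close>
  have "fold (colour m r) [0..<i] 1 =
      (if i = 0 \<or> (i \<le> 2 * r + 2) = odd i then 1 else 2)" for i
  proof (induction i)
    case (Suc i)
    have "colour m r i (if i = 0 \<or> (i \<le> 2 * r + 2) = odd i then 1 else 2) =
        (if (Suc i \<le> 2 * r + 2) = odd (Suc i) then 1 else 2)"
    proof (cases "i = 0 \<or> i = 2 * r + 2")
      case True
      then show ?thesis using assms(1) by (auto simp: colour_def)
    next
      case False
      then have "(Suc i \<le> 2 * r + 2) = (i < 2 * r + 2)" "(i \<le> 2 * r + 2) = (i < 2 * r + 2)" by auto
      then show ?thesis using False assms(1) by (auto simp: colour_def)
    qed
    then show ?case using Suc by simp
  qed simp
  from this[of "2 * n + 3"] show ?thesis using assms(2) by simp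
qed

text \<open>Just before \<open>x_i\<close> with \<open>i <= r\<close> the value is at most 1; if
  \<open>i < r\<close> and \<open>x_i\<close> is missing, the downward letter that follows leads
  into the trap 0. For \<open>i > r\<close>, two downward \<open>x_i\<close> take every value to
  0.\<close>

lemma colour_survivor:
  assumes m: "3 \<le> m" and c: "\<And>a. even a \<Longrightarrow> a < 2 * n + 3 \<Longrightarrow> c a = 1"
    and "r \<le> n" and survives: "fold (colour m r) (powers c (2 * n + 3)) 1 \<noteq> 0"
  shows "t < r \<Longrightarrow> 1 \<le> c (2 * t + 1)" and "r < t \<Longrightarrow> t \<le> n \<Longrightarrow> c (2 * t + 1) \<le> 1"
proof -
  define V where "V i = fold (colour m r) (powers c i) 1" for i
  have V_Suc: "V (Suc i) = (colour m r i ^^ c i) (V i)" for i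
    by (simp add: V_def powers_Suc fold_replicate)
  have V_le_2: "V i \<le> 2" for i
  proof (induction i)
    case (Suc i)
    have "(colour m r i ^^ k) y \<le> 2" if "y \<le> 2" for k y
      using that by (cases k) (auto simp: colour_le_2)
    then show ?case using Suc by (simp add: V_Suc)
  qed (simp add: V_def)
  have V_0: "V i = 0 \<Longrightarrow> i \<le> j \<Longrightarrow> V j = 0" for i j
  proof (induction j)
    case (Suc j)
    then show ?case by (cases "i = Suc j") (auto simp: V_Suc funpow_fixed colour_0 m)
  qed simp
  then have alive: "i \<le> 2 * n + 3 \<Longrightarrow> V i \<noteq> 0" for i
    using V_0[of i "2 * n + 3"] survives unfolding V_def by blast
  have down: "tri m 0 0 1 y \<le> 1" "y \<le> 1 \<Longrightarrow> tri m 0 0 1 y = 0" for y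
    by (auto simp: tri_def)
  have V_even: "V (2 * t + 3) = tri m 0 0 1 (V (2 * t + 2))" if "t < r" for t
  proof -
    have "c (2 * t + 2) = 1" using that \<open>r \<le> n\<close> by (intro c) auto
    moreover have "colour m r (2 * t + 2) = tri m 0 0 1" using that by (simp add: colour_def)
    ultimately show ?thesis using V_Suc[of "2 * t + 2"] by (simp add: numeral_3_eq_3)
  qed
  have V_low: "V (2 * t + 1) \<le> 1" if "t \<le> r" for t
  proof (cases t)
    case 0
    then show ?thesis using V_Suc[of 0] c[of 0] m by (simp add: V_def colour_def)
  next
    case (Suc s)
    then show ?thesis using V_even[of s] that down(1) by (simp add: numeral_3_eq_3)
  qed
  show "1 \<le> c (2 * t + 1)" if "t < r"
  proof (rule ccontr)
    assume "\<not> ?thesis"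
    then have "c (2 * t + 1) = 0" by linarith
    then have "V (2 * t + 2) = V (2 * t + 1)" using V_Suc[of "2 * t + 1"] by simp
    then have "V (2 * t + 3) = 0" using V_even[OF that] V_low[of t] that down(2) by simp
    then show False using alive[of "2 * t + 3"] that \<open>r \<le> n\<close> by simp
  qed
  show "c (2 * t + 1) \<le> 1" if "r < t" "t \<le> n"
  proof (rule ccontr)
    assume "\<not> ?thesis"
    then obtain j where j: "c (2 * t + 1) = Suc (Suc j)"
      by (metis One_nat_def le_SucI not0_implies_Suc le_refl le0)
    have "colour m r (2 * t + 1) = tri m 0 0 1" using that by (simp add: colour_def)
    then have "V (2 * t + 2) = (tri m 0 0 1 ^^ j) (tri m 0 0 1 (tri m 0 0 1 (V (2 * t + 1))))"
      using V_Suc[of "2 * t + 1"] j by (simp add: funpow_swap1)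
    also have "\<dots> = 0"
      using down(2)[OF down(1)] m by (simp add: funpow_fixed)
    finally show False using alive[of "2 * t + 2"] that by simp
  qed
qed

section \<open>An invariant of derivations from short identities\<close>

text \<open>This is the invariant: all \<open>w_k\<close> have it, \<open>w\<close> does not, and
  short valid identities preserve it.\<close>

definition good :: "nat \<Rightarrow> nat \<Rightarrow> nat list \<Rightarrow> bool" where
  "good m n q \<longleftrightarrow> dominated m n q \<and> q \<noteq> [0..<2 * n + 3]"

text \<open>The colouring yields at least one \<open>x_i\<close> for \<open>i < r\<close> and at
  most one for \<open>i > r\<close>. The former is bounded by \<open>dominated_no_square\<close>,
  since its successor occurs; the latter is forced by \<open>dominated_no_deletion\<close>, since
  its predecessor occurs at most once. So all exponents are 1.\<close>

lemma dominated_survivor_eq: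
  assumes q: "dominated m n q" and m: "3 \<le> m" and r: "r \<le> n"
    and once: "count_list q (2 * r + 1) = 1" and survives: "fold (colour m r) q 1 \<noteq> 0"
  shows "q = [0..<2 * n + 3]"
proof -
  note even = dominated_count_even[OF q m]
  note survivor = colour_survivor[where c = "count_list q", OF m even r,
      unfolded dominated_eq_powers[OF q m, symmetric], OF _ _ survives]
  have high: "1 \<le> count_list q (2 * t + 1)" if "t \<le> r" for t
    using survivor(1)[of t] that once by (cases "t = r") auto
  have low: "count_list q (2 * t + 1) \<le> 1" if "r \<le> t" "t \<le> n" for t
    using survivor(2)[of t] that once by (cases "t = r") auto
  have odd: "count_list q (2 * t + 1) = 1" if "t \<le> n" for t
  proof (cases "t < r")
    case True
    then have "1 \<le> count_list q (2 * t + 3)" using high[of "Suc t"] by (simp add: numeral_3_eq_3)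
    then have "count_list q (2 * t + 1) \<le> 1"
      using True r by (intro dominated_no_square[OF q m]) auto
    then show ?thesis using high[of t] True by linarith
  next
    case False
    show ?thesis
    proof (cases "t = r")
      case False
      then obtain s where s: "t = Suc s" "r \<le> s" using \<open>\<not> t < r\<close> by (cases t) auto
      then have "count_list q (2 * s + 3) \<noteq> 0"
        using that low[of s] by (intro dominated_no_deletion[OF q m]) auto
      then show ?thesis using low[of t] s that by (simp add: numeral_3_eq_3)
    qed (use once in simp)
  qed
  have "count_list q a = 1" if "a < 2 * n + 3" for a
  proof (cases "even a")
    case False
    then obtain t where "a = 2 * t + 1" by (rule oddE)
    then show ?thesis using odd[of t] that by simp
  qed (use even that in simp)
  then have "map (\<lambda>k. replicate (count_list q k) k) [0..<2 * n + 3] = map (\<lambda>k. replicate 1 k) [0..<2 * n + 3]"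
    by (intro map_cong) auto
  then have "powers (count_list q) (2 * n + 3) = powers (\<lambda>_. 1) (2 * n + 3)"
    by (simp only: powers_def)
  then show ?thesis using dominated_eq_powers[OF q m] powers_1 by metis
qed

text \<open>At each assignment and point, \<open>q\<close> lies below some word \<open>p\<close> of
  the other side, and the action of \<open>v\<close> is monotone.\<close>

lemma dominated_subst:
  assumes "holds_in_End m s t" "q \<in> words (subst \<sigma> t)"
    and "\<And>p. p \<in> words (subst \<sigma> s) \<Longrightarrow> dominated m n (u @ p @ v)"
  shows "dominated m n (u @ q @ v)"
  unfolding dominated_def
proof (intro allI impI)
  fix \<rho> :: "nat \<Rightarrow> nat \<Rightarrow> nat" and x
  assume \<rho>: "\<forall>a. \<rho> a \<in> EndC m" and x: "x < m"
  have EndC: "\<rho> a \<in> EndC m" for a using \<rho> by simp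
  let ?y = "fold \<rho> u x"
  have "?y < m" by (rule fold_EndC_less[OF EndC x])
  have "holds_in_End m (subst \<sigma> t) (subst \<sigma> s)"
    using assms(1) by (auto simp: holds_in_End_def eval_end_subst eval_end_EndC)
  then obtain p where p: "p \<in> words (subst \<sigma> s)" "fold \<rho> q ?y \<le> fold \<rho> p ?y"
    using holds_in_End_word[where \<rho> = \<rho>, OF _ assms(2) EndC \<open>?y < m\<close>] by blast
  have "fold \<rho> v (fold \<rho> q ?y) \<le> fold \<rho> v (fold \<rho> p ?y)"
    by (rule fold_EndC_mono[OF EndC p(2) fold_EndC_less[OF EndC \<open>?y < m\<close>]])
  moreover obtain k where "k \<le> Suc n" "fold \<rho> (u @ p @ v) x \<le> fold \<rho> (shift_word n k) x"
    using assms(3)[OF p(1)] \<rho> x unfolding dominated_def by blast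
  ultimately show "\<exists>k\<le>Suc n. fold \<rho> (u @ q @ v) x \<le> fold \<rho> (shift_word n k) x"
    by (intro exI[of _ k]) simp
qed

lemma count_list_concat: "count_list (concat bs) a = sum_list (map (\<lambda>b. count_list b a) bs)"
  by (induction bs) (auto simp: count_list_append)

text \<open>A block is a contiguous piece of \<open>w\<close>, where the letters next to
  \<open>x_r\<close> are even.\<close>

lemma neighbour_in_block:
  assumes "u @ concat bs @ v = [0..<2 * n + 3]" "b \<in> set bs" "2 * r + 1 \<in> set b" "b \<noteq> [2 * r + 1]"
  shows "\<exists>a. even a \<and> a \<in> set b"
proof -
  obtain cs ds where "bs = cs @ b # ds" using assms(2) by (meson split_list)
  then have eq: "[0..<2 * n + 3] = (u @ concat cs) @ b @ (concat ds @ v)" using assms(1) by simp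
  obtain e f where b: "b = e @ (2 * r + 1) # f" using assms(3) by (meson split_list)
  show ?thesis
  proof (cases f)
    case (Cons a f')
    let ?i = "length (u @ concat cs @ e)"
    have "[0..<2 * n + 3] ! ?i = 2 * r + 1" "[0..<2 * n + 3] ! Suc ?i = a"
      "Suc ?i < length [0..<2 * n + 3]"
      unfolding eq b Cons by (simp_all add: nth_append)
    then have "a = Suc (2 * r + 1)" by simp
    then show ?thesis using b Cons by (intro exI[of _ a]) auto
  next
    case Nil
    then obtain e' a where e: "e = e' @ [a]" using assms(4) b by (cases e rule: rev_cases) auto
    let ?i = "length (u @ concat cs @ e')"
    have "[0..<2 * n + 3] ! ?i = a" "[0..<2 * n + 3] ! Suc ?i = 2 * r + 1"
      "Suc ?i < length [0..<2 * n + 3]"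
      unfolding eq b e by (simp_all add: nth_append)
    then have "Suc a = 2 * r + 1" by simp
    then show ?thesis using b e by (intro exI[of _ a]) auto
  qed
qed

text \<open>In \<open>cs\<close> the blocks may be dropped, repeated or reordered. If some block
  contains \<open>x_r\<close>, it also contains a neighbouring even letter, and every block contains
  these two equally often; as the even letter is counted once, so is \<open>x_r\<close>. Otherwise
  \<open>x_r\<close> stands in \<open>u\<close> or \<open>v\<close>.\<close>

lemma count_in_blocks:
  assumes w: "u @ concat bs @ v = [0..<2 * n + 3]" and "r \<le> n" "[2 * r + 1] \<notin> set bs"
    and cs: "set cs \<subseteq> set bs"
    and even: "\<And>a. even a \<Longrightarrow> a < 2 * n + 3 \<Longrightarrow> count_list (u @ concat cs @ v) a = 1"
  shows "count_list (u @ concat cs @ v) (2 * r + 1) = 1"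
proof -
  let ?x = "2 * r + 1"
  have once: "count_list u a + count_list (concat bs) a + count_list v a = 1" if "a < 2 * n + 3" for a
  proof -
    have "count_list (u @ concat bs @ v) a = count_list (powers (\<lambda>_. 1) (2 * n + 3)) a"
      unfolding w powers_1 ..
    then show ?thesis using that by (simp add: count_list_powers count_list_append)
  qed
  have x: "?x < 2 * n + 3" using \<open>r \<le> n\<close> by simp
  show ?thesis
  proof (cases "count_list (concat bs) ?x = 0")
    case True
    then have "count_list (concat cs) ?x = 0"
      using cs by (auto simp: count_list_0_iff)
    then show ?thesis using once[OF x] True by (simp add: count_list_append)
  next
    case False
    then obtain b where b: "b \<in> set bs" "?x \<in> set b" by (auto simp: count_list_0_iff)
    then have "b \<noteq> [?x]" using assms(3) by auto
    then obtain a where a: "even a" "a \<in> set b"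
      using neighbour_in_block[OF w b] by blast
    have "set b \<subseteq> set (u @ concat bs @ v)" using b(1) by auto
    then have a_less: "a < 2 * n + 3" using a(2) unfolding w by auto
    obtain ds es where bs: "bs = ds @ b # es" using b(1) by (meson split_list)
    have pos: "count_list b ?x \<noteq> 0" "count_list b a \<noteq> 0"
      using a(2) b(2) by (auto simp: count_list_0_iff)
    have only_b: "count_list b' y = 0 \<and> y \<notin> set u \<and> y \<notin> set v"
      if "b' \<in> set bs" "b' \<noteq> b" "y = a \<or> y = ?x" for b' y
    proof -
      have "count_list u y + (count_list (concat ds) y + (count_list b y + count_list (concat es) y))
          + count_list v y = 1"
        using once[of y] that(3) x a_less bs by (auto simp: count_list_append)
      then have "count_list (concat ds) y = 0" "count_list (concat es) y = 0"
          "count_list u y = 0" "count_list v y = 0"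
        using pos that(3) by auto
      moreover have "b' \<in> set ds \<or> b' \<in> set es" using that(1,2) bs by auto
      ultimately show ?thesis by (auto simp: count_list_0_iff)
    qed
    have b_once: "count_list b y = 1" "count_list u y = 0" "count_list v y = 0"
      if "y = a \<or> y = ?x" for y
      using once[of y] that x a_less bs pos by (auto simp: count_list_append)
    have "count_list b' ?x = count_list b' a" if "b' \<in> set bs" for b'
      using only_b[OF that, of a] only_b[OF that, of ?x] b_once(1)[of a] b_once(1)[of ?x]
      by (cases "b' = b") auto
    then have "count_list (concat cs) ?x = count_list (concat cs) a"
      unfolding count_list_concat using cs by (intro arg_cong[of _ _ sum_list] map_cong) auto
    then show ?thesis
      using even[OF a(1) a_less] b_once(2,3)[of a] b_once(2,3)[of ?x] by (simp add: count_list_append)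
  qed
qed

text \<open>If the target word arose, it would be cut into \<^term>\<open>u\<close>, \<^term>\<open>v\<close> and at most
  \<^term>\<open>n\<close> blocks, so some letter \<open>x\<^sub>r\<close> is not a block on its own; evaluating the
  variables of the axiom at the blocks under the colouring for \<open>r\<close> yields a word on the other
  side of the axiom that survives the colouring, and this word must be the target word itself.\<close>

lemma good_subst:
  assumes m: "3 \<le> m" and st: "holds_in_End m s t" and size: "Suc (size t) \<le> n"
    and good: "\<And>p. p \<in> words (subst \<sigma> s) \<Longrightarrow> good m n (u @ p @ v)"
    and q: "q \<in> words (subst \<sigma> t)"
  shows "good m n (u @ q @ v)"
  unfolding good_def
proof (intro conjI notI)
  show "dominated m n (u @ q @ v)"
    by (rule dominated_subst[OF st q]) (use good in \<open>auto simp: good_def\<close>)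
  assume w: "u @ q @ v = [0..<2 * n + 3]"
  define A where "A = (\<lambda>z. words (\<sigma> z))"
  obtain bs where bs: "q = concat bs" "length bs \<le> Suc (size t)"
      "q \<in> choice_words (\<lambda>z. A z \<inter> set bs) t"
    using choice_words_blocks[OF q[unfolded words_subst]] unfolding A_def by blast
  have "\<exists>r\<le>n. [2 * r + 1] \<notin> set bs"
  proof (rule ccontr)
    assume "\<not> ?thesis"
    then have "(\<lambda>r. [2 * r + 1]) ` {..n} \<subseteq> set bs" by auto
    then have "card ((\<lambda>r. [2 * r + 1]) ` {..n}) \<le> length bs"
      by (rule le_trans[OF card_mono[OF finite_set] card_length])
    moreover have "card ((\<lambda>r. [2 * r + 1]) ` {..n}) = Suc n"
      by (subst card_image) (auto simp: inj_on_def)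
    ultimately show False using bs(2) size by simp
  qed
  then obtain r where r: "r \<le> n" "[2 * r + 1] \<notin> set bs" by blast
  define \<rho> where "\<rho> = colour m r"
  have \<rho>: "\<rho> a \<in> EndC m" "\<rho> a 0 = 0" for a
    unfolding \<rho>_def using m by (simp_all add: colour_EndC colour_0)
  \<comment> \<open>Only blocks of \<open>bs\<close> are offered, so the word found on the other
    side is again composed of them; 0 stands for a variable without such a block and keeps
    \<open>Max\<close> defined.\<close>
  define \<phi> where "\<phi> z x = (if x < m then Max (insert 0 ((\<lambda>b. fold \<rho> b x) ` (A z \<inter> set bs))) else 0)" for z x
  have fin: "finite (insert 0 ((\<lambda>b. fold \<rho> b x) ` (A z \<inter> set bs)))" for z x by simp
  have \<phi>: "\<phi> z \<in> EndC m" for z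
  proof (rule EndC_I)
    fix x assume "x < m"
    then show "\<phi> z x < m" using fold_EndC_less[where \<rho> = \<rho>, OF \<rho>(1)] by (auto simp: \<phi>_def)
  next
    fix x y :: nat assume xy: "x \<le> y" "y < m"
    have "fold \<rho> b x \<le> Max (insert 0 ((\<lambda>b. fold \<rho> b y) ` (A z \<inter> set bs)))" if "b \<in> A z \<inter> set bs" for b
      by (rule order_trans[OF fold_EndC_mono[where \<rho> = \<rho>, OF \<rho>(1) xy] Max_ge[OF fin]]) (use that in auto)
    then show "\<phi> z x \<le> \<phi> z y" using xy by (simp add: \<phi>_def)
  qed (simp add: \<phi>_def)
  have \<phi>_upper: "fold \<rho> b x \<le> \<phi> z x" if "b \<in> A z \<inter> set bs" "x < m" for b z x
    using that by (simp add: \<phi>_def)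
  have \<phi>_attained: "\<exists>b\<in>A z \<inter> set bs. fold \<rho> b x = \<phi> z x" if "0 < \<phi> z x" "x < m" for z x
    using Max_in[OF fin, of x z] that by (auto simp: \<phi>_def)
  let ?y = "fold \<rho> u 1"
  have y: "?y < m" by (rule fold_EndC_less[where \<rho> = \<rho>, OF \<rho>(1)]) (use m in simp)
  have "fold \<rho> (u @ q @ v) 1 = 2" unfolding w \<rho>_def by (rule colour_target[OF m r(1)])
  then have target: "fold \<rho> v (fold \<rho> q ?y) = 2" by simp
  \<comment> \<open>The target value is 2 and 0 is a trap, so \<open>q\<close> yields a positive
    value; only such values are sure to be attained by blocks.\<close>
  then have pos: "0 < fold \<rho> q ?y"
    using fold_bottom[where \<rho> = \<rho> and q = v, OF \<rho>(2)] by (cases "fold \<rho> q ?y = 0") auto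
  have "fold \<rho> q ?y \<le> eval_end m \<phi> t ?y"
    by (rule eval_end_upper[where \<rho> = \<rho>, OF \<rho>(1) \<phi> \<phi>_upper bs(3) y])
  also have "eval_end m \<phi> t = eval_end m \<phi> s"
    using st \<phi> by (simp add: holds_in_End_def)
  finally have le: "fold \<rho> q ?y \<le> eval_end m \<phi> s ?y" .
  have "\<exists>p\<in>choice_words (\<lambda>z. A z \<inter> set bs) s. fold \<rho> p ?y = eval_end m \<phi> s ?y"
    by (rule eval_end_attained_blocks[where \<rho> = \<rho>, OF \<rho>(2) \<phi> \<phi>_attained y]) (use pos le in simp_all)
  then obtain p where p: "p \<in> choice_words (\<lambda>z. A z \<inter> set bs) s" "fold \<rho> p ?y = eval_end m \<phi> s ?y"
    by blast
  have "p \<in> words (subst \<sigma> s)"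
    using p(1) choice_words_mono[of "\<lambda>z. A z \<inter> set bs" A s] unfolding words_subst A_def by blast
  then have p_good: "good m n (u @ p @ v)" by (rule good)
  obtain cs where cs: "p = concat cs" "set cs \<subseteq> set bs"
    using choice_words_concat[OF p(1)] by blast
  have "fold \<rho> q ?y \<le> fold \<rho> p ?y" using le p(2) by simp
  then have "fold \<rho> v (fold \<rho> q ?y) \<le> fold \<rho> v (fold \<rho> p ?y)"
    using fold_EndC_mono[where \<rho> = \<rho>, OF \<rho>(1)] fold_EndC_less[where \<rho> = \<rho>, OF \<rho>(1) y] by blast
  then have "fold (colour m r) (u @ p @ v) 1 \<noteq> 0" using target by (simp add: \<rho>_def)
  moreover have "dominated m n (u @ p @ v)" using p_good by (simp add: good_def)
  moreover have "count_list (u @ p @ v) (2 * r + 1) = 1"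
    unfolding cs(1)
    by (rule count_in_blocks[OF _ r cs(2)])
      (use w bs(1) dominated_count_even[OF calculation(2) m] cs(1) in auto)
  ultimately have "u @ p @ v = [0..<2 * n + 3]"
    using dominated_survivor_eq[OF _ m r(1)] by blast
  then show False using p_good by (simp add: good_def)
qed

lemma ball_words_Times:
  "(\<forall>q\<in>words (Times s t). P q) \<longleftrightarrow> (\<forall>q1\<in>words s. \<forall>q2\<in>words t. P (q1 @ q2))"
  by auto

text \<open>The contexts \<open>u\<close> and \<open>v\<close> vary in the induction because in a
  product each factor is replaced while the words of the other factor are part of its
  context.\<close>

lemma good_derivable:
  assumes "derivable E s t" and m: "3 \<le> m"
    and E: "\<And>s t. (s, t) \<in> E \<Longrightarrow> holds_in_End m s t \<and> Suc (size s) \<le> n \<and> Suc (size t) \<le> n"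
  shows "(\<forall>q\<in>words s. good m n (u @ q @ v)) \<longleftrightarrow> (\<forall>q\<in>words t. good m n (u @ q @ v))"
  using assms(1)
proof (induction arbitrary: u v)
  case (ax s t \<sigma>)
  have st: "holds_in_End m s t" "holds_in_End m t s" "Suc (size s) \<le> n" "Suc (size t) \<le> n"
    using E[OF ax] by (auto simp: holds_in_End_def)
  show ?case using good_subst[OF m st(1,4)] good_subst[OF m st(2,3)] by blast
next
  case (cong_plus s1 t1 s2 t2)
  then show ?case by (simp add: ball_Un)
next
  case (cong_times s1 t1 s2 t2)
  have "(\<forall>q\<in>words (Times s1 s2). good m n (u @ q @ v)) \<longleftrightarrow>
      (\<forall>q2\<in>words s2. \<forall>q1\<in>words s1. good m n (u @ q1 @ (q2 @ v)))"
    unfolding ball_words_Times append_assoc by blast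
  also have "\<dots> \<longleftrightarrow> (\<forall>q1\<in>words t1. \<forall>q2\<in>words s2. good m n ((u @ q1) @ q2 @ v))"
    unfolding cong_times.IH(1) append_assoc by blast
  also have "\<dots> \<longleftrightarrow> (\<forall>q\<in>words (Times t1 t2). good m n (u @ q @ v))"
    using cong_times.IH(2)[of "u @ q" v for q] unfolding ball_words_Times append_assoc by blast
  finally show ?case .
qed blast+

section \<open>The contradiction for chains with at least three elements\<close>

fun sum_term :: "nat list \<Rightarrow> nat list list \<Rightarrow> trm" where
  "sum_term q [] = word_term q"
| "sum_term q (p # ps) = Plus (word_term q) (sum_term p ps)"

lemma words_sum_term: "[] \<notin> insert q (set ps) \<Longrightarrow> words (sum_term q ps) = insert q (set ps)"
proof (induction q ps rule: sum_term.induct)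
  case (2 q p ps)
  then have "words (word_term q) = {q}" by (intro words_word_term) auto
  with 2 show ?case by (simp add: insert_commute)
qed (simp add: words_word_term)

lemma not_finite_identity_basis:
  assumes m: "3 \<le> m"
  shows "\<not> has_finite_identity_basis m"
proof
  assume "has_finite_identity_basis m"
  then obtain E where E: "finite E" "\<And>s t. (s, t) \<in> E \<Longrightarrow> holds_in_End m s t"
      "\<And>s t. holds_in_End m s t \<Longrightarrow> derivable E s t"
    unfolding has_finite_identity_basis_def by blast
  \<comment> \<open>The sum over the finite set \<open>E\<close> bounds the number of leaves on
    either side of each of its identities.\<close>
  define n where "n = (\<Sum>(s, t)\<in>E. Suc (size s + size t))"
  have bound: "Suc (size s) \<le> n \<and> Suc (size t) \<le> n" if "(s, t) \<in> E" for s t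
  proof -
    have "(case (s, t) of (s, t) \<Rightarrow> Suc (size s + size t)) \<le> n"
      unfolding n_def by (rule member_le_sum[OF that _ E(1)]) simp
    then show ?thesis by simp
  qed
  define w where "w = [0..<2 * n + 3]"
  define p where "p = sum_term (shift_word n 0) (map (shift_word n) [1..<n + 2])"
  have "0 \<in> set (shift_word n k)" for k
  proof -
    have "count_list (shift_word n k) 0 \<noteq> 0"
      by (simp add: shift_word_def count_list_powers shift_exp_def)
    then show ?thesis by (simp add: count_list_0_iff)
  qed
  then have "[] \<notin> range (shift_word n)" by (metis empty_iff imageE list.set(1))
  then have ne: "[] \<notin> insert (shift_word n 0) (set (map (shift_word n) [1..<n + 2]))"
    by (simp only: set_map) blast
  have "words p = insert (shift_word n 0) (shift_word n ` {1..<n + 2})"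
    unfolding p_def words_sum_term[OF ne] set_map set_upt ..
  moreover have "insert 0 {1..<n + 2} = {..Suc n}" by auto
  ultimately have words_p: "words p = shift_word n ` {..Suc n}" by (metis image_insert)
  have words_w: "words (word_term w) = {w}" by (rule words_word_term) (simp add: w_def)
  \<comment> \<open>The identity \<open>p + w = p\<close> is valid by
    \<open>shift_words_upper\<close>, but all words of \<open>p\<close> are good and
    \<open>w\<close> is not.\<close>
  have "holds_in_End m (Plus p (word_term w)) p"
    unfolding holds_in_End_def
  proof (intro allI impI ext)
    fix \<rho> :: "nat \<Rightarrow> nat \<Rightarrow> nat" and x
    assume "\<forall>a. \<rho> a \<in> EndC m"
    then have \<rho>: "\<rho> a \<in> EndC m" for a by simp
    show "eval_end m \<rho> (Plus p (word_term w)) x = eval_end m \<rho> p x"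
    proof (cases "x < m")
      case True
      obtain k where k: "k \<le> Suc n" "fold \<rho> w x \<le> fold \<rho> (shift_word n k) x"
        using shift_words_upper[where \<rho> = \<rho>, OF \<rho> True] unfolding w_def by blast
      have "eval_end m \<rho> (word_term w) x = fold \<rho> w x"
        using eval_end_attained[where \<rho> = \<rho>, OF \<rho> True, of "word_term w"] words_w by simp
      also have "\<dots> \<le> fold \<rho> (shift_word n k) x" by (rule k(2))
      also have "\<dots> \<le> eval_end m \<rho> p x"
        by (rule eval_end_words_upper[where \<rho> = \<rho>, OF \<rho> _ True]) (use words_p k(1) in auto)
      finally show ?thesis using True by (simp add: end_add_def)
    next
      case False
      then show ?thesis
        using EndC_outside[OF eval_end_EndC[where \<rho> = \<rho>, OF \<rho>], of x p] by (simp add: end_add_def)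
    qed
  qed
  then have "derivable E (Plus p (word_term w)) p" by (rule E(3))
  then have iff: "(\<forall>q\<in>words (Plus p (word_term w)). good m n ([] @ q @ [])) \<longleftrightarrow>
      (\<forall>q\<in>words p. good m n ([] @ q @ []))"
    by (rule good_derivable[OF _ m]) (use E(2) bound in blast)
  have "good m n (shift_word n k)" if "k \<le> Suc n" for k
  proof -
    have "shift_word n k \<noteq> w"
    proof
      assume "shift_word n k = w"
      then have "powers (shift_exp k) (2 * n + 3) = powers (\<lambda>_. 1) (2 * n + 3)"
        unfolding shift_word_def powers_1 w_def .
      then have "count_list (powers (shift_exp k) (2 * n + 3)) a = count_list (powers (\<lambda>_. 1) (2 * n + 3)) a" for a
        by simp
      then have eq: "shift_exp k a = 1" if "a < 2 * n + 3" for a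
        using that unfolding count_list_powers by metis
      \<comment> \<open>\<open>w_k\<close> differs from \<open>w\<close> in the deleted letter
        \<open>x_k\<close>, or, for \<open>k = n + 1\<close>, in the squared letter
        \<open>x_n\<close>.\<close>
      show False
      proof (cases "k \<le> n")
        case True
        then show False using eq[of "2 * k + 1"] by (simp add: shift_exp_def)
      next
        case False
        then have "k = Suc n" using that by simp
        then show False using eq[of "2 * n + 1"] by (simp add: shift_exp_def)
      qed
    qed
    moreover have "dominated m n (shift_word n k)"
      unfolding dominated_def using that by blast
    ultimately show ?thesis by (simp add: good_def w_def)
  qed
  then have "\<forall>q\<in>words p. good m n q" using words_p by auto
  then have "good m n w" using iff words_w by simp
  then show False by (simp add: good_def w_def)
qed

theorem theorem6p4:
  fixes m :: nat
  assumes "m \<ge> 1"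
  shows "has_finite_identity_basis m \<longleftrightarrow> m \<le> 2"
proof -
  consider "m = 1" | "m = 2" | "3 \<le> m" using assms by linarith
  then show ?thesis
    by cases (use finite_identity_basis_1 finite_identity_basis_2 not_finite_identity_basis in auto)
qed

end
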